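(* Let $p\in[1/2,1)$, $q=1-p$, and let $\bar g=\{g_j\}_{j\in\mathbb N}$ be a real sequence with $\sup_j|g_j|<\infty$. Let $\gamma$ be a probability measure on $\mathbb R^\infty$ such that $\gamma$-a.e. $\bar x=\{x_j\}_{j\in\mathbb N}$ is non-decreasing and satisfies $$\liminf_{M\to\infty}\frac{x_M}{\sqrt M}>0 .$$ Then solutions to the infinite system of competing Brownian particles with parameters $p,\bar g$ and initial distribution $\gamma$ are pathwise unique among all solutions whose associated local times $\{L_{(j,j+1)}\}$ satisfy: for all $T\in[0,\infty)$, $$\limsup_{M\to\infty}\ \sup_{s\in[0,T]}\frac{qL_{(M,M+1)}(s)-pL_{(M-1,M)}(s)}{1\vee X_M(0)}\le 0\quad\text{a.s.}$$ That is, if $\{X_j\}$ and $\{X'_j\}$ are two solutions to the infinite system of competing Brownian particles with parameters $p,\bar g$ on the same filtered probability space, with the same driving Brownian motions, initial distribution $\gamma$, and $X_j(0)=X'_j(0)$ for all $j$, and if the local times $\{L_{(j,j+1)}\}$ of $\{X_j\}$ and $\{L'_{(j,j+1)}\}$ of $\{X'_j\}$ satisfy, for all $T\in[0,\infty)$, $\limsup_{M\to\infty}\sup_{s\in[0,T]}\frac{qL_{(M,M+1)}(s)-pL_{(M-1,M)}(s)}{1\vee X_M(0)}\le 0$ a.s. and $\limsup_{M\to\infty}\sup_{s\in[0,T]}\frac{qL'_{(M,M+1)}(s)-pL'_{(M-1,M)}(s)}{1\vee X'_M(0)}\le 0$ a.s., then almost surely $X_j(t)=X'_j(t)$ for all $j\in\mathbb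 N$ and $t\in[0,\infty)$.
   Context: Setting. $(\Omega,\mathcal F,\{\mathcal F_t\}_{t\ge0},\mathbb P)$ is a filtered probability space carrying independent standard one-dimensional ($\mathcal F_t$-adapted) Brownian motions $\{B_j\}_{j\in\mathbb N}$ such that $\{B_i(t+\cdot)-B_i(t),\,i\in\mathbb N\}$ is independent of $\mathcal F_t$ for all $t\ge0$, and $\bar x=\{x_j\}_{j\in\mathbb N}$ is a non-decreasing sequence of real $\mathcal F_0$-measurable random variables (initial conditions); the law of $\bar x$ is the initial distribution. An infinite system of competing Brownian particles (a solution) with parameters $p,\bar g$, initial conditions $\bar x$ and driving Brownian motions $\{B_j\}$ is a collection $\{X_j\}_{j\in\mathbb N}$ of continuous, real-valued, $\{\mathcal F_t\}$-adapted processes for which there are continuous, real-valued, $\{\mathcal F_t\}$-adapted processes $\{L_{(j,j+1)}\}_{j\ge0}$ (the associated local times) such that: (P1) for all $t\ge0$, $j\in\mathbb N$: $X_j(t)=x_j+g_jt+B_j(t)+pL_{(j-1,j)}(t)-qL_{(j,j+1)}(t)$; (P2) for all $t\ge0$ the sequence $\{X_j(t)\}_{j\in\mathbb N}$ is non-decreasing; (P3) $L_{(0,1)}\equiv0$, and for $j\ge1$, $L_{(j,j+1)}$ is non-decreasing with $L_{(j,j+1)}(0)=0$ and $\int_0^\infty(X_{j+1}(t)-X_j(t))\,dL_{(j,j+1)}(t)=0$. *)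

theory Defs
  imports "HOL-Probability.Probability"
begin

text \<open>
  The index set \<open>\<nat> = {1, 2, \<dots>}\<close> is rendered by the guard \<open>1 \<le> j\<close> on the type \<^typ>\<open>nat\<close>, and
  time \<open>[0, \<infinity>)\<close> by the guard \<open>0 \<le> t\<close> on \<^typ>\<open>real\<close>; values outside these ranges are junk and are
  never constrained. Processes take the time before the outcome: \<open>Y t \<omega>\<close>, \<open>X j t \<omega>\<close>.
  Properties of sample paths (continuity, equations, monotonicity) are required almost surely, with
  one exceptional null set for all times and all indices.
\<close>

definition adapted :: "(real \<Rightarrow> 'a measure) \<Rightarrow> (real \<Rightarrow> 'a \<Rightarrow> real) \<Rightarrow> bool" where
  "adapted F Y \<longleftrightarrow> (\<forall>t\<ge>0. Y t \<in> borel_measurable (F t))"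

definition standard_brownian_motion :: "'a measure \<Rightarrow> (real \<Rightarrow> 'a \<Rightarrow> real) \<Rightarrow> bool" where
  "standard_brownian_motion M W \<longleftrightarrow>
     (\<forall>t\<ge>0. W t \<in> borel_measurable M) \<and>
     (AE \<omega> in M. W 0 \<omega> = 0) \<and>
     (\<forall>s t. 0 \<le> s \<longrightarrow> s < t \<longrightarrow>
        distributed M lborel (\<lambda>\<omega>. W t \<omega> - W s \<omega>) (normal_density 0 (sqrt (t - s)))) \<and>
     (\<forall>(n::nat) \<tau>. 0 \<le> \<tau> 0 \<longrightarrow> (\<forall>i<n. \<tau> i \<le> \<tau> (Suc i)) \<longrightarrow>
        prob_space.indep_vars M (\<lambda>_. borel) (\<lambda>i \<omega>. W (\<tau> (Suc i)) \<omega> - W (\<tau> i) \<omega>) {..<n}) \<and>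
     (AE \<omega> in M. continuous_on {0..} (\<lambda>t. W t \<omega>))"

text \<open>
  The library locale \<^locale>\<open>filtration\<close> is indexed by the whole type \<^typ>\<open>real\<close>; any filtration on
  \<open>[0, \<infinity>)\<close> extends to it, e.g. by \<open>F t = F 0\<close> for \<open>t < 0\<close>, and negative times are not used.
  No completeness or right-continuity of the filtration is assumed.
\<close>

locale brownian_setup = prob_space M + filtration "space M" F
  for M :: "'a measure" and F :: "real \<Rightarrow> 'a measure" +
  fixes B :: "nat \<Rightarrow> real \<Rightarrow> 'a \<Rightarrow> real"
  assumes subalgebra_F: "0 \<le> t \<Longrightarrow> subalgebra M (F t)"
    and brownian_B: "1 \<le> j \<Longrightarrow> standard_brownian_motion M (B j)"
    and adapted_B: "1 \<le> j \<Longrightarrow> adapted F (B j)"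
    and indep_B:
      "indep_vars (\<lambda>_. \<Pi>\<^sub>M t\<in>{0..}. borel) (\<lambda>j \<omega>. \<lambda>t\<in>{0..}. B j t \<omega>) {1..}"
    and indep_increments_F: "0 \<le> t \<Longrightarrow>
      indep_set (sets (F t))
        (sets (vimage_algebra (space M)
           (\<lambda>\<omega>. \<lambda>(i, s)\<in>{1..} \<times> {0..}. B i (t + s) \<omega> - B i t \<omega>)
           (\<Pi>\<^sub>M (i, s)\<in>{1..} \<times> {0..}. borel)))"

text \<open>
  The Lebesgue-Stieltjes measure \<open>dA\<close> of a continuous non-decreasing \<open>A\<close> on \<open>[0, \<infinity>)\<close>: freezing
  \<open>A\<close> at \<open>A 0\<close> for negative times puts no mass on \<open>(-\<infinity>, 0]\<close>.
\<close>

definition stieltjes :: "(real \<Rightarrow> real) \<Rightarrow> real measure" where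
  "stieltjes A = interval_measure (\<lambda>t. A (max 0 t))"

text \<open>
  \<open>L j\<close> is the local time \<open>L\<^sub>(\<^sub>j\<^sub>,\<^sub>j\<^sub>+\<^sub>1\<^sub>)\<close>, for \<open>j \<ge> 0\<close>. The integral in the last condition is a
  nonnegative one: its integrand is nonnegative on every path that is ordered, so the coercion
  \<^const>\<open>ennreal\<close> cuts nothing off.
\<close>

definition competing_path ::
  "real \<Rightarrow> (nat \<Rightarrow> real) \<Rightarrow> (nat \<Rightarrow> real) \<Rightarrow> (nat \<Rightarrow> real \<Rightarrow> real) \<Rightarrow>
   (nat \<Rightarrow> real \<Rightarrow> real) \<Rightarrow> (nat \<Rightarrow> real \<Rightarrow> real) \<Rightarrow> bool" where
  "competing_path p g x b X L \<longleftrightarrow>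
     (\<forall>j\<ge>1. continuous_on {0..} (X j)) \<and>
     (\<forall>j. continuous_on {0..} (L j)) \<and>
     (\<forall>t\<ge>0. \<forall>j\<ge>1. X j t = x j + g j * t + b j t + p * L (j - 1) t - (1 - p) * L j t) \<and>
     (\<forall>t\<ge>0. mono_on {1..} (\<lambda>j. X j t)) \<and>
     (\<forall>t\<ge>0. L 0 t = 0) \<and>
     (\<forall>j\<ge>1. mono_on {0..} (L j) \<and> L j 0 = 0 \<and>
        (\<integral>\<^sup>+ t \<in> {0..}. ennreal (X (j + 1) t - X j t) \<partial>stieltjes (L j)) = 0)"

definition competing_brownian_solution ::
  "'a measure \<Rightarrow> (real \<Rightarrow> 'a measure) \<Rightarrow> (nat \<Rightarrow> real \<Rightarrow> 'a \<Rightarrow> real) \<Rightarrow> real \<Rightarrow> (nat \<Rightarrow> real) \<Rightarrow>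
   (nat \<Rightarrow> 'a \<Rightarrow> real) \<Rightarrow> (nat \<Rightarrow> real \<Rightarrow> 'a \<Rightarrow> real) \<Rightarrow> (nat \<Rightarrow> real \<Rightarrow> 'a \<Rightarrow> real) \<Rightarrow> bool" where
  "competing_brownian_solution M F B p g x X L \<longleftrightarrow>
     (\<forall>j\<ge>1. x j \<in> borel_measurable (F 0)) \<and>
     (AE \<omega> in M. mono_on {1..} (\<lambda>j. x j \<omega>)) \<and>
     (\<forall>j\<ge>1. adapted F (X j)) \<and>
     (\<forall>j. adapted F (L j)) \<and>
     (AE \<omega> in M. competing_path p g (\<lambda>j. x j \<omega>)
        (\<lambda>j t. B j t \<omega>) (\<lambda>j t. X j t \<omega>) (\<lambda>j t. L j t \<omega>))"

abbreviation real_sequences :: "(nat \<Rightarrow> real) measure" where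
  "real_sequences \<equiv> \<Pi>\<^sub>M j\<in>{1..}. borel"

definition has_initial_distribution ::
  "'a measure \<Rightarrow> (nat \<Rightarrow> 'a \<Rightarrow> real) \<Rightarrow> (nat \<Rightarrow> real) measure \<Rightarrow> bool" where
  "has_initial_distribution M x \<gamma> \<longleftrightarrow> distr M real_sequences (\<lambda>\<omega>. \<lambda>j\<in>{1..}. x j \<omega>) = \<gamma>"

definition local_time_growth ::
  "'a measure \<Rightarrow> real \<Rightarrow> (nat \<Rightarrow> real \<Rightarrow> 'a \<Rightarrow> real) \<Rightarrow> (nat \<Rightarrow> real \<Rightarrow> 'a \<Rightarrow> real) \<Rightarrow> bool" where
  "local_time_growth M p X L \<longleftrightarrow>
     (\<forall>T\<ge>0. AE \<omega> in M.
        limsup (\<lambda>n. SUP s\<in>{0..T}.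
          ereal (((1 - p) * L n s \<omega> - p * L (n - 1) s \<omega>) / max 1 (X n 0 \<omega>))) \<le> 0)"

end

theory Submission
  imports Defs
begin

text \<open>
  The difference of the two solutions can be created only by information that travels down from
  infinitely high particles, and within a short time nothing travels that far.

  Fix a path. As long as \<open>L m\<close> is constant, the particles \<open>1, \<dots>, m\<close> of \<open>X\<close> are not pushed from above,
  and they stay above those of any other solution \<open>X'\<close> that starts below (\<open>comparison_while_not_pushed\<close>): the quantity
  \<open>\<Sum>i\<le>m. (q/p)^i * (max 0 (X' i - X i))\<^sup>2\<close> does not increase, because the weights \<open>(q/p)^i\<close> make the
  two pushes exerted by one local time balance, and at a collision the order of the gaps gives the
  remaining term the right sign.

  Suppose now that \<open>X k t < X' k t\<close> although the solutions agree at time \<open>a\<close>. Going back from \<open>t\<close> to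
  the last collision of the particles \<open>k\<close> and \<open>k + 1\<close>, the comparison must already have failed
  there among the particles up to \<open>k + 1\<close>; going back from there to the last collision of \<open>k + 1\<close>
  and \<open>k + 2\<close>, it must have failed even earlier, and so on without end
  (\<open>comparison_failure_gives_chain\<close>). This produces times
  \<open>t = \<sigma> 0 \<ge> \<sigma> 1 \<ge> \<dots> \<ge> a\<close> such that, between two consecutive ones, the current particle is only
  pushed upwards. Following the chain downwards from particle \<open>n\<close> therefore loses at most the sum of
  the Brownian increments along the chain plus a bounded drift (\<open>chain_lower_bound\<close>).

  That sum is a Brownian last passage quantity: over a time span \<open>d\<close> and \<open>n\<close> particles it is at most
  \<open>9 * sqrt (d * n)\<close> for all large \<open>n\<close>, simultaneously for all chains
  (\<open>AE_increments_along_chains_bounded\<close>). On the other hand the growth of the initial positions and the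
  bound on the local times keep particle \<open>n\<close> above \<open>c * sqrt n\<close> during any bounded time
  (\<open>AE_particles_stay_high\<close>). If \<open>9 * sqrt d < c\<close>, particle \<open>k\<close> would have to sit arbitrarily high,
  which is absurd. Hence \<open>X' \<le> X\<close>, and by symmetry \<open>X = X'\<close>, on time intervals of length \<open>d\<close>, and
  finitely many such intervals exhaust any bounded time (\<open>paths_agree\<close>).
\<close>

section \<open>Local times grow only at collisions\<close>

lemma competing_pathD:
  assumes "competing_path p g x b X L"
  shows competing_path_continuous: "1 \<le> j \<Longrightarrow> continuous_on {0..} (X j)"
    and local_time_continuous: "continuous_on {0..} (L i)"
    and competing_path_eq: "1 \<le> j \<Longrightarrow> 0 \<le> t \<Longrightarrow>
      X j t = x j + g j * t + b j t + p * L (j - 1) t - (1 - p) * L j t"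
    and competing_path_ordered: "1 \<le> j \<Longrightarrow> 0 \<le> t \<Longrightarrow> X j t \<le> X (j + 1) t"
    and local_time_0: "0 \<le> t \<Longrightarrow> L 0 t = 0"
    and local_time_mono: "1 \<le> j \<Longrightarrow> mono_on {0..} (L j)"
    and local_time_le: "0 \<le> s \<Longrightarrow> s \<le> t \<Longrightarrow> L i s \<le> L i t"
    and local_time_start: "L i 0 = 0"
    and local_time_integral: "1 \<le> j \<Longrightarrow>
      (\<integral>\<^sup>+ t \<in> {0..}. ennreal (X (j + 1) t - X j t) \<partial>stieltjes (L j)) = 0"
proof -
  show mono: "mono_on {0..} (L j)" if "1 \<le> j" for j
    using assms that unfolding competing_path_def by blast
  show zero: "L 0 t = 0" if "0 \<le> t" for t
    using assms that unfolding competing_path_def by blast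
  show "1 \<le> j \<Longrightarrow> 0 \<le> t \<Longrightarrow> X j t \<le> X (j + 1) t"
    using assms mono_onD[of "{1..}" "\<lambda>j. X j t" j "j + 1"] unfolding competing_path_def by simp
  show "0 \<le> s \<Longrightarrow> s \<le> t \<Longrightarrow> L i s \<le> L i t"
    using zero[of s] zero[of t] mono_onD[OF mono, of i s t] by (cases "i = 0") auto
  show "L i 0 = 0"
    using assms unfolding competing_path_def by (cases "i = 0") auto
qed (use assms in \<open>simp_all add: competing_path_def\<close>)

text \<open>
  Without a collision the gap between the two particles would be bounded below on the compact
  interval, and its integral against \<open>dL\<close> would be at least that bound times the increase of \<open>L\<close>.
\<close>

lemma collision_if_local_time_increases:
  assumes path: "competing_path p g x b X L" and j: "1 \<le> j"
    and uv: "0 \<le> u" "u \<le> v" and inc: "L j u < L j v"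
  obtains r where "u \<le> r" "r \<le> v" "X j r = X (j + 1) r"
proof (rule ccontr)
  assume no: "\<not> thesis"
  note X_cont = competing_path_continuous[OF path] and L_cont = local_time_continuous[OF path]
    and L_mono = local_time_mono[OF path j] and ord = competing_path_ordered[OF path j]
    and integral0 = local_time_integral[OF path j]
  define A where "A t = L j (max 0 t)" for t
  have A_mono: "A s \<le> A t" if "s \<le> t" for s t
    unfolding A_def using that by (intro mono_onD[OF L_mono]) auto
  have A_cont: "continuous_on UNIV A"
    unfolding A_def by (intro continuous_on_compose2[OF L_cont] continuous_intros) auto
  then have A_right: "continuous (at_right t) A" for t
    by (simp add: continuous_on_eq_continuous_at continuous_at_imp_continuous_at_within)
  have pos: "0 < X (j + 1) r - X j r" if "r \<in> {u..v}" for r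
    using ord[of r] that no uv \<open>\<And>r. u \<le> r \<Longrightarrow> r \<le> v \<Longrightarrow> X j r = X (j + 1) r \<Longrightarrow> thesis\<close>
    by (force simp: order_less_le)
  have gap_cont: "continuous_on {u..v} (\<lambda>r. X (j + 1) r - X j r)"
    using uv j by (intro continuous_intros continuous_on_subset[OF X_cont]) auto
  obtain m where m: "m \<in> {u..v}" "\<And>r. r \<in> {u..v} \<Longrightarrow> X (j + 1) m - X j m \<le> X (j + 1) r - X j r"
    using continuous_attains_inf[OF compact_Icc _ gap_cont] uv by fastforce
  define c where "c = X (j + 1) m - X j m"
  have "c > 0" using pos[OF m(1)] by (simp add: c_def)
  have "emeasure (stieltjes (L j)) {u<..v} = ennreal (A v - A u)"
    unfolding stieltjes_def A_def[symmetric, abs_def]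
    by (intro emeasure_interval_measure_Ioc A_mono A_right uv) 
  moreover have "A v - A u > 0"
    using inc uv by (simp add: A_def max_def)
  ultimately have "0 < ennreal c * emeasure (stieltjes (L j)) {u<..v}"
    using \<open>c > 0\<close> by (simp add: ennreal_zero_less_mult_iff)
  also have "\<dots> = (\<integral>\<^sup>+ t. ennreal c * indicator {u<..v} t \<partial>stieltjes (L j))"
    by (subst nn_integral_cmult_indicator) (auto simp: stieltjes_def)
  also have "\<dots> \<le> (\<integral>\<^sup>+ t \<in> {0..}. ennreal (X (j + 1) t - X j t) \<partial>stieltjes (L j))"
    using m(2) uv by (intro nn_integral_mono) (auto split: split_indicator simp: c_def intro!: ennreal_leI)
  finally show False using integral0 by simp
qed

lemma local_time_flat_if_no_collision:
  assumes path: "competing_path p g x b X L" and j: "1 \<le> j"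
    and uv: "0 \<le> u" "u \<le> v" and no: "\<And>r. u \<le> r \<Longrightarrow> r \<le> v \<Longrightarrow> X j r \<noteq> X (j + 1) r"
  shows "L j u = L j v"
proof -
  have "L j u \<le> L j v"
    using local_time_le[OF path] uv by blast
  moreover have "\<not> L j u < L j v"
    using collision_if_local_time_increases[OF path j uv] no by metis
  ultimately show ?thesis by simp
qed

text \<open>
  After the last collision the local time is frozen; by continuity it already has its final value
  at that collision.
\<close>

lemma last_collision:
  assumes path: "competing_path p g x b X L" and j: "1 \<le> j"
    and ar: "0 \<le> a" and r: "a \<le> r" "r \<le> \<tau>" "X j r = X (j + 1) r"
  obtains \<sigma> where "a \<le> \<sigma>" "\<sigma> \<le> \<tau>" "X j \<sigma> = X (j + 1) \<sigma>" "L j \<sigma> = L j \<tau>"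
proof -
  note X_cont = competing_path_continuous[OF path] and L_cont = local_time_continuous[OF path]
    and L_mono = local_time_mono[OF path j]
  define S where "S = {s \<in> {a..\<tau>}. X j s - X (j + 1) s = 0}"
  have "closed S" unfolding S_def
    using ar j by (intro continuous_closed_preimage_constant continuous_intros
        continuous_on_subset[OF X_cont]) auto
  moreover have "S \<noteq> {}" using r by (auto simp: S_def)
  moreover have bdd: "bdd_above S" by (auto simp: S_def bdd_above_def)
  ultimately have in_S: "Sup S \<in> S" by (intro closed_contains_Sup)
  have "L j (Sup S) = L j \<tau>"
  proof (rule ccontr)
    assume "L j (Sup S) \<noteq> L j \<tau>"
    moreover have "L j (Sup S) \<le> L j \<tau>"
      using in_S ar by (intro mono_onD[OF L_mono]) (auto simp: S_def)
    ultimately have lt: "L j (Sup S) < L j \<tau>" by simp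
    then obtain y where y: "L j (Sup S) < y" "y < L j \<tau>" using dense by blast
    obtain u where u: "Sup S \<le> u" "u \<le> \<tau>" "L j u = y"
      using IVT'[of "L j" "Sup S" y \<tau>] y in_S ar continuous_on_subset[OF L_cont]
      by (auto simp: S_def)
    then have "Sup S < u" using y by (cases "Sup S = u") auto
    have "0 \<le> u" using u in_S ar by (auto simp: S_def)
    then obtain s where "u \<le> s" "s \<le> \<tau>" "X j s = X (j + 1) s"
      using collision_if_local_time_increases[OF path j, of u \<tau>] u y by auto
    then have "s \<in> S" using \<open>Sup S < u\<close> in_S by (auto simp: S_def)
    then show False using cSup_upper[OF _ bdd] \<open>u \<le> s\<close> \<open>Sup S < u\<close> by fastforce
  qed
  with in_S show ?thesis by (intro that[of "Sup S"]) (auto simp: S_def)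
qed

section \<open>Comparison below a particle that is not pushed from above\<close>

text \<open>
  The inequality adds up over a partition. It turns an error that is a small multiple of the
  variation of a monotone function on short intervals into the same multiple of its total variation.
\<close>

lemma increment_le_if_locally_le:
  fixes F V :: "real \<Rightarrow> real"
  assumes "s \<le> t" and d: "d > 0"
    and loc: "\<And>u v. s \<le> u \<Longrightarrow> u \<le> v \<Longrightarrow> v \<le> t \<Longrightarrow> v - u < d \<Longrightarrow> F v - F u \<le> V v - V u"
  shows "F t - F s \<le> V t - V s"
proof -
  obtain n :: nat where n: "(t - s) / d < real n" using reals_Archimedean2 by blast
  define h where "h = (t - s) / real n"
  show ?thesis
  proof (cases "n = 0")
    case True
    with n \<open>s \<le> t\<close> d have False by (simp add: divide_less_0_iff)
    then show ?thesis ..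
  next
    case False
    have h: "0 \<le> h" "h < d" "s + real n * h = t"
      using n False \<open>s \<le> t\<close> d by (auto simp: h_def field_simps)
    have "k \<le> n \<Longrightarrow> F (s + real k * h) - F s \<le> V (s + real k * h) - V s" for k
    proof (induction k)
      case (Suc k)
      have "real (Suc k) * h \<le> real n * h" using Suc.prems h by (intro mult_right_mono) auto
      then have "F (s + real (Suc k) * h) - F (s + real k * h)
          \<le> V (s + real (Suc k) * h) - V (s + real k * h)"
        using h by (intro loc) (auto simp: algebra_simps)
      then show ?case using Suc by simp
    qed simp
    from this[of n] show ?thesis using h by simp
  qed
qed

text \<open>
  The tangent inequality of the convex function \<open>y \<mapsto> (max 0 y)\<^sup>2\<close>. It takes the place of the chain rule
  for functions of bounded variation: only increments over small intervals enter, never integrals.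
\<close>

lemma square_pos_part_convex:
  fixes y z :: real
  shows "(max 0 y)\<^sup>2 - (max 0 z)\<^sup>2 \<le> 2 * max 0 y * (y - z)"
proof -
  have "0 \<le> (y - z)\<^sup>2" by simp
  then have "y\<^sup>2 - z\<^sup>2 \<le> 2 * y * (y - z)" by (simp add: power2_eq_square algebra_simps)
  moreover have "y\<^sup>2 \<le> 2 * y * (y - z)" if "y > 0" "z \<le> 0"
  proof -
    have "y * z \<le> 0" "0 \<le> y * y" using that by (auto simp: mult_le_0_iff)
    then have "2 * (y * z) \<le> y * y" by linarith
    then show ?thesis by (simp add: power2_eq_square algebra_simps)
  qed
  ultimately show ?thesis by (cases "y > 0"; cases "z > 0") (auto simp: max_def)
qed

text \<open>
  The local time between the particles \<open>i\<close> and \<open>i + 1\<close> pushes the lower one with factor \<open>q\<close> and the upper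
  one with factor \<open>p\<close>. With weights proportional to \<open>(q/p)^i\<close> the two contributions have the same size, so
  that only the difference of the slopes \<open>a\<close> and one boundary term survive.
\<close>

lemma weighted_summation_by_parts:
  fixes w a \<Delta> :: "nat \<Rightarrow> real"
  assumes w: "\<And>i. p * w (Suc i) = q * w i" and "\<Delta> 0 = 0"
  shows "(\<Sum>i=1..Suc n. w i * a i * (p * \<Delta> (i - 1) - q * \<Delta> i)) =
    (\<Sum>i=1..n. q * w i * \<Delta> i * (a (Suc i) - a i)) - q * w (Suc n) * a (Suc n) * \<Delta> (Suc n)"
proof (induction n)
  case 0
  then show ?case using assms by simp
next
  case (Suc n)
  show ?case
    unfolding sum.cl_ivl_Suc[of _ 1 "Suc n"] Suc sum.cl_ivl_Suc[of _ 1 n]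
    using w[of "Suc n"] by (simp add: algebra_simps)
qed

text \<open>
  Let \<open>D i = X' i - X i\<close>. When \<open>L' i\<close> grows, the particles \<open>i\<close> and \<open>i + 1\<close> of \<open>X'\<close> meet while those of \<open>X\<close>
  are ordered, so \<open>D (i + 1) \<le> D i\<close>; when \<open>L i\<close> grows, the inequality is reversed. In both cases the
  interaction lowers the weighted sum of \<open>(max 0 (D i))\<^sup>2\<close>. At the top, \<open>L m\<close> does not move, and \<open>L' m\<close>
  can only push \<open>X'\<close> further down. Collisions take place somewhere inside a short interval and not at
  its end, which costs an error of the order of the oscillation of \<open>D\<close> times the increase of the local
  times; it vanishes as the partition is refined.
\<close>

lemma comparison_while_not_pushed:
  assumes path: "competing_path p g x b X L" and path': "competing_path p g x' b X' L'"
    and p: "0 < p" "p < 1" and st: "0 \<le> s" "s \<le> t" and m: "1 \<le> m"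
    and flat: "L m s = L m t"
    and init: "\<And>i. i \<in> {1..m} \<Longrightarrow> X' i s \<le> X i s" and k: "k \<in> {1..m}"
  shows "X' k t \<le> X k t"
proof -
  define q where "q = 1 - p"
  define D where "D i r = X' i r - X i r" for i r
  define w where "w i = (q / p) ^ i" for i :: nat
  have q: "0 < q" and w_pos: "w i > 0" and w_Suc: "p * w (Suc i) = q * w i" for i
    using p by (auto simp: q_def w_def)
  obtain n where n: "m = Suc n" using m by (cases m) auto
  define \<Psi> where "\<Psi> r = (\<Sum>i=1..m. w i * (max 0 (D i r))\<^sup>2)" for r
  define V where "V r = (\<Sum>i=1..n. q * w i * (L i r + L' i r))" for r
  have L_mono: "L i u \<le> L i v" "L' i u \<le> L' i v" if "0 \<le> u" "u \<le> v" for i u v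
    using local_time_le[OF path that] local_time_le[OF path' that] by auto
  have ord: "X i r \<le> X (Suc i) r" "X' i r \<le> X' (Suc i) r" if "0 \<le> r" "1 \<le> i" for i r
    using competing_path_ordered[OF path that(2,1)] competing_path_ordered[OF path' that(2,1)] by auto
  note X_eq = competing_path_eq[OF path, folded q_def]
    and X'_eq = competing_path_eq[OF path', folded q_def]
  have D_cont: "continuous_on {s..t} (D i)" if "1 \<le> i" for i
    unfolding D_def using st that
    by (intro continuous_intros continuous_on_subset[OF competing_path_continuous[OF path]]
        continuous_on_subset[OF competing_path_continuous[OF path']]) auto
  \<comment> \<open>\<open>a i\<close> is the slope of \<open>(max 0 y)\<^sup>2\<close> at \<open>y = D i v\<close>; it has Lipschitz constant 2 in \<open>D i v\<close>,
    and moving from the collision time \<open>r\<close> to \<open>v\<close> changes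
    \<open>D i\<close> and \<open>D (i + 1)\<close> by \<open>\<epsilon>\<close> each, whence the 4.\<close>
  have step: "\<Psi> v - \<Psi> u \<le> 4 * \<epsilon> * (V v - V u)"
    if uv: "s \<le> u" "u \<le> v" "v \<le> t"
      and osc: "\<And>i r. i \<in> {1..m} \<Longrightarrow> u \<le> r \<Longrightarrow> r \<le> v \<Longrightarrow> \<bar>D i r - D i v\<bar> \<le> \<epsilon>" for u v \<epsilon>
  proof -
    define a where "a i = 2 * max 0 (D i v)" for i
    define \<Delta> where "\<Delta> i = (L' i v - L' i u) - (L i v - L i u)" for i
    have u0: "0 \<le> u" using uv st by simp
    have "0 \<le> \<epsilon>" using osc[of m v] uv m by auto
    have "\<Delta> 0 = 0" using u0 uv by (simp add: \<Delta>_def local_time_0[OF path] local_time_0[OF path'])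
    have D_inc: "D i v - D i u = p * \<Delta> (i - 1) - q * \<Delta> i" if "i \<in> {1..m}" for i
      using that u0 uv by (simp add: D_def \<Delta>_def X_eq X'_eq algebra_simps)
    have "\<Psi> v - \<Psi> u = (\<Sum>i=1..m. w i * ((max 0 (D i v))\<^sup>2 - (max 0 (D i u))\<^sup>2))"
      by (simp add: \<Psi>_def sum_subtractf algebra_simps)
    also have "\<dots> \<le> (\<Sum>i=1..m. w i * (a i * (D i v - D i u)))"
      using w_pos by (intro sum_mono mult_left_mono) (auto simp: a_def less_imp_le square_pos_part_convex)
    also have "\<dots> = (\<Sum>i=1..m. w i * a i * (p * \<Delta> (i - 1) - q * \<Delta> i))"
      by (intro sum.cong refl) (simp add: D_inc mult.assoc)
    also have "\<dots> = (\<Sum>i=1..n. q * w i * \<Delta> i * (a (Suc i) - a i)) - q * w m * a m * \<Delta> m"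
      unfolding n by (rule weighted_summation_by_parts) (use w_Suc \<open>\<Delta> 0 = 0\<close> in auto)
    also have "\<dots> \<le> (\<Sum>i=1..n. q * w i * \<Delta> i * (a (Suc i) - a i))"
    proof -
      have "L m u = L m v"
        using L_mono(1)[of s u m] L_mono(1)[of u v m] L_mono(1)[of v t m] flat m uv st by auto
      then have "0 \<le> \<Delta> m" using L_mono(2)[of u v m] m u0 uv by (simp add: \<Delta>_def)
      then have "0 \<le> q * w m * a m * \<Delta> m"
        using q w_pos[of m] by (intro mult_nonneg_nonneg) (auto simp: a_def)
      then show ?thesis by simp
    qed
    also have "\<dots> \<le> (\<Sum>i=1..n. q * w i * (4 * \<epsilon> * ((L' i v - L' i u) + (L i v - L i u))))"
    proof (rule sum_mono)
      fix i assume i: "i \<in> {1..n}"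
      have im: "i \<in> {1..m}" "Suc i \<in> {1..m}" "1 \<le> i" using i n by auto
      have up: "(L' i v - L' i u) * (a (Suc i) - a i) \<le> (L' i v - L' i u) * (4 * \<epsilon>)"
      proof (cases "L' i u < L' i v")
        case True
        then obtain r where r: "u \<le> r" "r \<le> v" "X' i r = X' (i + 1) r"
          using collision_if_local_time_increases[OF path' \<open>1 \<le> i\<close> u0] uv by blast
        then have "D (Suc i) r \<le> D i r" using ord(1)[of r i] im u0 by (simp add: D_def)
        then have "D (Suc i) v \<le> D i v + 2 * \<epsilon>"
          using osc[OF im(1) r(1,2)] osc[OF im(2) r(1,2)] by linarith
        then have "a (Suc i) - a i \<le> 4 * \<epsilon>" using \<open>0 \<le> \<epsilon>\<close> by (simp add: a_def)
        then show ?thesis using True by (intro mult_left_mono) auto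
      next
        case False
        then show ?thesis using L_mono(2)[OF u0 uv(2), of i] by simp
      qed
      have down: "(L i v - L i u) * (a i - a (Suc i)) \<le> (L i v - L i u) * (4 * \<epsilon>)"
      proof (cases "L i u < L i v")
        case True
        then obtain r where r: "u \<le> r" "r \<le> v" "X i r = X (i + 1) r"
          using collision_if_local_time_increases[OF path \<open>1 \<le> i\<close> u0] uv by blast
        then have "D i r \<le> D (Suc i) r" using ord(2)[of r i] im u0 by (simp add: D_def)
        then have "D i v \<le> D (Suc i) v + 2 * \<epsilon>"
          using osc[OF im(1) r(1,2)] osc[OF im(2) r(1,2)] by linarith
        then have "a i - a (Suc i) \<le> 4 * \<epsilon>" using \<open>0 \<le> \<epsilon>\<close> by (simp add: a_def)
        then show ?thesis using True by (intro mult_left_mono) auto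
      next
        case False
        then show ?thesis using L_mono(1)[OF u0 uv(2), of i] by simp
      qed
      have "\<Delta> i * (a (Suc i) - a i) \<le> 4 * \<epsilon> * ((L' i v - L' i u) + (L i v - L i u))"
        using up down by (simp add: \<Delta>_def algebra_simps)
      moreover have "0 \<le> q * w i" using q w_pos[of i] by simp
      ultimately show "q * w i * \<Delta> i * (a (Suc i) - a i)
          \<le> q * w i * (4 * \<epsilon> * ((L' i v - L' i u) + (L i v - L i u)))"
        unfolding mult.assoc[of "q * w i"] by (rule mult_left_mono)
    qed
    also have "\<dots> = 4 * \<epsilon> * (V v - V u)"
      by (simp add: V_def sum_subtractf[symmetric] sum_distrib_left algebra_simps)
    finally show ?thesis .
  qed
  have small: "\<Psi> t - \<Psi> s \<le> 4 * \<epsilon> * (V t - V s)" if "\<epsilon> > 0" for \<epsilon>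
  proof -
    have "\<exists>d>0. \<forall>r\<in>{s..t}. \<forall>v\<in>{s..t}. \<bar>r - v\<bar> < d \<longrightarrow> \<bar>D i r - D i v\<bar> < \<epsilon>" if "1 \<le> i" for i
      using compact_uniformly_continuous[OF D_cont[OF that] compact_Icc] \<open>\<epsilon> > 0\<close>
      unfolding uniformly_continuous_on_def dist_real_def by metis
    then obtain d where d: "\<And>i. 1 \<le> i \<Longrightarrow> d i > 0"
      and osc: "\<And>i r v. 1 \<le> i \<Longrightarrow> r \<in> {s..t} \<Longrightarrow> v \<in> {s..t} \<Longrightarrow> \<bar>r - v\<bar> < d i \<Longrightarrow> \<bar>D i r - D i v\<bar> < \<epsilon>"
      by metis
    define d0 where "d0 = Min (d ` {1..m})"
    have "d0 > 0" using d m by (auto simp: d0_def)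
    moreover have "d0 \<le> d i" if "i \<in> {1..m}" for i using that by (auto simp: d0_def)
    ultimately have d0: "d0 > 0" "\<And>i. i \<in> {1..m} \<Longrightarrow> d0 \<le> d i" by auto
    have "\<Psi> t - \<Psi> s \<le> 4 * \<epsilon> * V t - 4 * \<epsilon> * V s"
    proof (rule increment_le_if_locally_le[OF st(2) d0(1)])
      fix u v assume uv: "s \<le> u" "u \<le> v" "v \<le> t" "v - u < d0"
      have "\<bar>D i r - D i v\<bar> \<le> \<epsilon>" if "i \<in> {1..m}" "u \<le> r" "r \<le> v" for i r
        using osc[of i r v] d0(2)[OF that(1)] that uv by auto
      from step[OF uv(1-3) this] show "\<Psi> v - \<Psi> u \<le> 4 * \<epsilon> * V v - 4 * \<epsilon> * V u"
        by (simp add: algebra_simps)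
    qed
    then show ?thesis by (simp add: algebra_simps)
  qed
  have "\<Psi> t - \<Psi> s \<le> 0"
  proof (rule tendsto_lowerbound)
    show "((\<lambda>\<epsilon>. 4 * \<epsilon> * (V t - V s)) \<longlongrightarrow> 0) (at_right 0)"
      by (auto intro!: tendsto_eq_intros)
    show "\<forall>\<^sub>F \<epsilon> in at_right 0. \<Psi> t - \<Psi> s \<le> 4 * \<epsilon> * (V t - V s)"
      using small eventually_at_right_less[of "0::real"] by (auto elim: eventually_mono)
  qed simp
  moreover have "\<Psi> s = 0"
    unfolding \<Psi>_def using init by (intro sum.neutral) (auto simp: D_def)
  ultimately have "\<Psi> t \<le> 0" by simp
  moreover have "w k * (max 0 (D k t))\<^sup>2 \<le> \<Psi> t"
    unfolding \<Psi>_def using k w_pos by (intro member_le_sum) (auto simp: less_imp_le)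
  ultimately have "(max 0 (D k t))\<^sup>2 \<le> 0"
    using w_pos[of k] by (metis mult_le_0_iff not_less order_trans)
  then show ?thesis by (simp add: D_def)
qed

section \<open>Chains of collisions\<close>

text \<open>
  If \<open>m\<close> and \<open>m + 1\<close> never collide before \<open>\<tau>\<close>, the lowest \<open>m\<close> particles of \<open>X\<close> are not pushed from above
  since time \<open>a\<close>, and the comparison cannot fail. Otherwise they are not pushed from above after the last
  collision \<open>\<sigma>\<close>, so a failure after \<open>\<sigma>\<close> must stem from one before \<open>\<sigma>\<close>. It is recorded for \<open>m + 1\<close>
  particles, which is what the next step up needs.
\<close>

lemma comparison_failure_moves_up:
  assumes path: "competing_path p g x b X L" and path': "competing_path p g x' b X' L'"
    and p: "0 < p" "p < 1" and a: "0 \<le> a"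
    and init: "\<And>i. 1 \<le> i \<Longrightarrow> X' i a \<le> X i a"
    and m: "1 \<le> m" and \<tau>: "a \<le> \<tau>"
    and fail: "\<exists>i\<in>{1..m}. \<exists>r\<in>{a..\<tau>}. X i r < X' i r"
  obtains \<sigma> where "a \<le> \<sigma>" "\<sigma> \<le> \<tau>" "X m \<sigma> = X (m + 1) \<sigma>" "L m \<sigma> = L m \<tau>"
    "\<exists>i\<in>{1..m + 1}. \<exists>r\<in>{a..\<sigma>}. X i r < X' i r"
proof -
  obtain i r where i: "i \<in> {1..m}" and r: "r \<in> {a..\<tau>}" and lt: "X i r < X' i r"
    using fail by blast
  note L_mono = local_time_le[OF path, of _ _ m]
  have flat_between: "L m u = L m r" if "a \<le> u" "u \<le> r" "L m u = L m \<tau>" for u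
    using L_mono[of u r] L_mono[of r \<tau>] that r a by auto
  have "\<exists>\<rho>. a \<le> \<rho> \<and> \<rho> \<le> \<tau> \<and> X m \<rho> = X (m + 1) \<rho>"
  proof (rule ccontr)
    assume "\<not> ?thesis"
    then have "L m a = L m \<tau>"
      by (intro local_time_flat_if_no_collision[OF path m a \<tau>]) auto
    then have "X' i r \<le> X i r"
      using flat_between[of a] r a init i
      by (intro comparison_while_not_pushed[OF path path' p a, of r m]) (auto simp: m)
    then show False using lt by simp
  qed
  then obtain \<sigma> where \<sigma>: "a \<le> \<sigma>" "\<sigma> \<le> \<tau>" "X m \<sigma> = X (m + 1) \<sigma>" "L m \<sigma> = L m \<tau>"
    using last_collision[OF path m a] by metis
  have "\<exists>i\<in>{1..m + 1}. \<exists>r\<in>{a..\<sigma>}. X i r < X' i r"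
  proof (rule ccontr)
    assume none: "\<not> ?thesis"
    then have le: "X' k u \<le> X k u" if "k \<in> {1..m}" "a \<le> u" "u \<le> \<sigma>" for k u
      using that by (fastforce simp: not_less)
    with lt i r have "\<sigma> < r" by (metis atLeastAtMost_iff linorder_not_le)
    then have "X' i r \<le> X i r"
      using \<sigma> flat_between[of \<sigma>] le i a
      by (intro comparison_while_not_pushed[OF path path' p, of \<sigma> r m]) (auto simp: m)
    then show False using lt by simp
  qed
  with \<sigma> show ?thesis by (intro that)
qed

text \<open>
  The iteration never stops: each failure yields another one, earlier and one particle further up.
  What is carried along is a failure of some particle up to \<open>k + n\<close> at some time up to \<open>\<sigma> n\<close>; which
  particle it is may change from step to step.
\<close>

lemma comparison_failure_gives_chain:
  assumes path: "competing_path p g x b X L" and path': "competing_path p g x' b X' L'"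
    and p: "0 < p" "p < 1" and a: "0 \<le> a"
    and init: "\<And>i. 1 \<le> i \<Longrightarrow> X' i a \<le> X i a"
    and k: "1 \<le> k" and t: "a \<le> t" and fail: "X k t < X' k t"
  obtains \<sigma> where "\<sigma> 0 = t" "\<And>n. a \<le> \<sigma> n" "\<And>n. \<sigma> (Suc n) \<le> \<sigma> n"
    "\<And>n. X (k + n) (\<sigma> (Suc n)) = X (k + Suc n) (\<sigma> (Suc n))"
    "\<And>n. L (k + n) (\<sigma> (Suc n)) = L (k + n) (\<sigma> n)"
proof -
  define P where "P n \<tau> \<longleftrightarrow> a \<le> \<tau> \<and> (n = 0 \<longrightarrow> \<tau> = t) \<and>
    (\<exists>i\<in>{1..k + n}. \<exists>r\<in>{a..\<tau>}. X i r < X' i r)" for n \<tau>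
  define Q where "Q n \<tau> \<sigma> \<longleftrightarrow> \<sigma> \<le> \<tau> \<and> X (k + n) \<sigma> = X (k + Suc n) \<sigma> \<and>
    L (k + n) \<sigma> = L (k + n) \<tau>" for n \<tau> \<sigma>
  have "\<exists>\<tau>. P 0 \<tau>" using k t fail by (force simp: P_def)
  moreover have "\<exists>\<sigma>. P (Suc n) \<sigma> \<and> Q n \<tau> \<sigma>" if "P n \<tau>" for n \<tau>
    using that k comparison_failure_moves_up[OF path path' p a init, of "k + n" \<tau>]
    unfolding P_def Q_def by (metis Suc_eq_plus1 add_Suc_right nat.simps(3) trans_le_add1)
  ultimately obtain \<sigma> where "\<And>n. P n (\<sigma> n)" "\<And>n. Q n (\<sigma> n) (\<sigma> (Suc n))"
    using dependent_nat_choice[of P Q] by blast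
  then show ?thesis by (intro that[of \<sigma>]) (auto simp: P_def Q_def)
qed

text \<open>
  Between \<open>\<sigma> (n + 1)\<close> and \<open>\<sigma> n\<close> the particle \<open>k + n\<close> receives no push from above, so apart from its drift
  and its Brownian increment it can only rise; at \<open>\<sigma> (n + 1)\<close> the next particle of the chain
  is at the same position.
\<close>

lemma chain_lower_bound:
  assumes path: "competing_path p g x b X L" and p: "0 < p" "p < 1" and k: "1 \<le> k"
    and G: "\<And>j. 1 \<le> j \<Longrightarrow> \<bar>g j\<bar> \<le> G"
    and \<sigma>: "\<And>n. 0 \<le> \<sigma> n" "\<And>n. \<sigma> (Suc n) \<le> \<sigma> n"
    and meet: "\<And>n. X (k + n) (\<sigma> (Suc n)) = X (k + Suc n) (\<sigma> (Suc n))"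
    and flat: "\<And>n. L (k + n) (\<sigma> (Suc n)) = L (k + n) (\<sigma> n)"
  shows "X (k + n) (\<sigma> n) \<le> X k (\<sigma> 0) + G * (\<sigma> 0 - \<sigma> n)
    + (\<Sum>i<n. \<bar>b (k + i) (\<sigma> i) - b (k + i) (\<sigma> (Suc i))\<bar>)"
proof (induction n)
  case 0
  then show ?case by simp
next
  case (Suc n)
  let ?j = "k + n" and ?s = "\<sigma> (Suc n)" and ?t = "\<sigma> n"
  have X_eq: "X ?j r = x ?j + g ?j * r + b ?j r + p * L (?j - 1) r - (1 - p) * L ?j r"
    if "0 \<le> r" for r
    using competing_path_eq[OF path _ that, of ?j] k by simp
  have "L (?j - 1) ?s \<le> L (?j - 1) ?t"
    by (rule local_time_le[OF path \<sigma>])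
  then have "p * L (?j - 1) ?s \<le> p * L (?j - 1) ?t" using p by simp
  moreover have "(- g ?j) * (?t - ?s) \<le> G * (?t - ?s)"
    using G[of ?j] k \<sigma>(2)[of n] by (intro mult_right_mono) auto
  ultimately have "X ?j ?s \<le> X ?j ?t + G * (?t - ?s) + \<bar>b ?j ?t - b ?j ?s\<bar>"
    using \<sigma> flat[of n] by (simp add: X_eq algebra_simps)
  then show ?case using Suc meet[of n] by (simp add: algebra_simps)
qed

text \<open>
  A chain of length \<open>n\<close> would give \<open>(c - K) * sqrt n \<le> X k t + const\<close> for all large \<open>n\<close>.
\<close>

lemma comparison_if_chains_are_short:
  assumes path: "competing_path p g x b X L" and path': "competing_path p g x' b X' L'"
    and p: "0 < p" "p < 1" and a: "0 \<le> a"
    and G: "\<And>j. 1 \<le> j \<Longrightarrow> \<bar>g j\<bar> \<le> G"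
    and chains: "\<forall>\<^sub>F n in sequentially. \<forall>\<sigma>. (\<forall>j. \<sigma> j \<in> {a..e}) \<and> antimono \<sigma> \<longrightarrow>
      (\<Sum>j=1..n. \<bar>b j (\<sigma> (j - 1)) - b j (\<sigma> j)\<bar>) \<le> K * sqrt (real n)"
    and growth: "\<forall>\<^sub>F n in sequentially. \<forall>s\<in>{a..e}. c * sqrt (real n) \<le> X n s"
    and Kc: "K < c"
    and init: "\<And>i. 1 \<le> i \<Longrightarrow> X' i a \<le> X i a"
    and k: "1 \<le> k" and t: "a \<le> t" "t \<le> e"
  shows "X' k t \<le> X k t"
proof (rule ccontr)
  assume "\<not> ?thesis"
  then have "X k t < X' k t" by simp
  then obtain \<sigma> where \<sigma>: "\<sigma> 0 = t" "\<And>n. a \<le> \<sigma> n" "\<And>n. \<sigma> (Suc n) \<le> \<sigma> n"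
    "\<And>n. X (k + n) (\<sigma> (Suc n)) = X (k + Suc n) (\<sigma> (Suc n))"
    "\<And>n. L (k + n) (\<sigma> (Suc n)) = L (k + n) (\<sigma> n)"
    using comparison_failure_gives_chain[OF path path' p a init k t(1)] by metis
  have \<sigma>_anti: "antimono \<sigma>" using \<sigma>(3) by (rule decseq_SucI)
  have \<sigma>_le: "\<sigma> n \<le> e" for n using antimonoD[OF \<sigma>_anti, of 0 n] \<sigma>(1) t by simp
  have "0 \<le> G" using G[of 1] by simp
  \<comment> \<open>The chain starts at particle \<open>k\<close>, whereas the bound on increments is for chains that start at
    particle 1. Truncated subtraction makes
    \<open>\<rho>\<close> wait at time \<open>t\<close> for the particles below \<open>k\<close>.\<close>
  define \<rho> where "\<rho> j = \<sigma> (Suc j - k)" for j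
  have \<rho>: "\<rho> j \<in> {a..e}" "antimono \<rho>" for j
    using \<sigma>(2) \<sigma>_le antimonoD[OF \<sigma>_anti] by (auto simp: \<rho>_def intro!: antimonoI)
  define C where "C = X k t + G * (e - a)"
  have "\<forall>\<^sub>F n in sequentially. (c - K) * sqrt (real n) \<le> C"
    using chains growth eventually_ge_at_top[of k]
  proof eventually_elim
    case (elim n)
    have "(\<Sum>i<n - k. \<bar>b (k + i) (\<sigma> i) - b (k + i) (\<sigma> (Suc i))\<bar>)
        = (\<Sum>j=k..<n. \<bar>b j (\<rho> (j - 1)) - b j (\<rho> j)\<bar>)"
      using k \<open>k \<le> n\<close>
      by (intro sum.reindex_bij_witness[of _ "\<lambda>j. j - k" "\<lambda>i. k + i"])
        (auto simp: \<rho>_def Suc_diff_le)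
    also have "\<dots> \<le> (\<Sum>j=1..n. \<bar>b j (\<rho> (j - 1)) - b j (\<rho> j)\<bar>)"
      using k by (intro sum_mono2) auto
    also have "\<dots> \<le> K * sqrt (real n)" using elim(1) \<rho> by blast
    finally have sum_le: "(\<Sum>i<n - k. \<bar>b (k + i) (\<sigma> i) - b (k + i) (\<sigma> (Suc i))\<bar>) \<le> K * sqrt (real n)" .
    have "c * sqrt (real n) \<le> X (k + (n - k)) (\<sigma> (n - k))"
      using elim(2,3) \<sigma>(2) \<sigma>_le by simp
    also have "\<dots> \<le> X k (\<sigma> 0) + G * (\<sigma> 0 - \<sigma> (n - k))
        + (\<Sum>i<n - k. \<bar>b (k + i) (\<sigma> i) - b (k + i) (\<sigma> (Suc i))\<bar>)"
      using a \<sigma>(2) by (intro chain_lower_bound[OF path p k G _ \<sigma>(3-5)]) (auto intro: order_trans)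
    also have "\<dots> \<le> C + K * sqrt (real n)"
      using sum_le \<sigma>(1,2) t \<open>0 \<le> G\<close> unfolding C_def
      by (intro add_mono mult_left_mono) (auto intro: diff_mono)
    finally show ?case by (simp add: algebra_simps)
  qed
  moreover have "filterlim (\<lambda>n. (c - K) * sqrt (real n)) at_top sequentially"
    using Kc by (intro filterlim_tendsto_pos_mult_at_top[OF tendsto_const]
        filterlim_compose[OF sqrt_at_top filterlim_real_sequentially]) auto
  then have "\<forall>\<^sub>F n in sequentially. C < (c - K) * sqrt (real n)"
    by (simp add: filterlim_at_top_dense)
  ultimately have "\<forall>\<^sub>F n in sequentially. False" by eventually_elim simp
  then show False by simp
qed

section \<open>Oscillation of Brownian paths\<close>

text \<open>
  Completing the square turns the exponentially tilted density into the density of a shifted normal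
  distribution.
\<close>

lemma nn_integral_exp_normal:
  assumes Y: "distributed M lborel Y (normal_density 0 \<sigma>)" and \<sigma>: "0 < \<sigma>"
  shows "(\<integral>\<^sup>+\<omega>. ennreal (exp (l * Y \<omega>)) \<partial>M) = ennreal (exp (l\<^sup>2 * \<sigma>\<^sup>2 / 2))"
proof -
  have shift: "normal_density 0 \<sigma> y * exp (l * y) = exp (l\<^sup>2 * \<sigma>\<^sup>2 / 2) * normal_density (l * \<sigma>\<^sup>2) \<sigma> y" for y
  proof -
    have "- y\<^sup>2 / (2 * \<sigma>\<^sup>2) + l * y = l\<^sup>2 * \<sigma>\<^sup>2 / 2 + - (y - l * \<sigma>\<^sup>2)\<^sup>2 / (2 * \<sigma>\<^sup>2)"
      using \<sigma> by (simp add: field_simps power2_eq_square)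
    then have "exp (- y\<^sup>2 / (2 * \<sigma>\<^sup>2)) * exp (l * y) = exp (l\<^sup>2 * \<sigma>\<^sup>2 / 2) * exp (- (y - l * \<sigma>\<^sup>2)\<^sup>2 / (2 * \<sigma>\<^sup>2))"
      by (simp only: exp_add[symmetric])
    then show ?thesis by (simp add: normal_density_def mult_ac)
  qed
  have "(\<integral>\<^sup>+\<omega>. ennreal (exp (l * Y \<omega>)) \<partial>M) =
      (\<integral>\<^sup>+y. ennreal (normal_density 0 \<sigma> y) * ennreal (exp (l * y)) \<partial>lborel)"
    by (rule distributed_nn_integral[OF Y, symmetric]) simp
  also have "\<dots> = (\<integral>\<^sup>+y. ennreal (exp (l\<^sup>2 * \<sigma>\<^sup>2 / 2)) * ennreal (normal_density (l * \<sigma>\<^sup>2) \<sigma> y) \<partial>lborel)"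
    by (simp add: ennreal_mult'[symmetric] shift)
  also have "\<dots> = ennreal (exp (l\<^sup>2 * \<sigma>\<^sup>2 / 2)) * (\<integral>\<^sup>+y. ennreal (normal_density (l * \<sigma>\<^sup>2) \<sigma> y) \<partial>lborel)"
    by (rule nn_integral_cmult) simp
  also have "(\<integral>\<^sup>+y. ennreal (normal_density (l * \<sigma>\<^sup>2) \<sigma> y) \<partial>lborel) = 1"
    using prob_space.emeasure_space_1[OF prob_space_normal_density[OF \<sigma>, of "l * \<sigma>\<^sup>2"]]
    by (simp add: emeasure_density)
  finally show ?thesis by simp
qed

text \<open>
  The waiting time recursion of a random walk with steps \<open>\<xi>\<close>; unrolled, it is the largest of the sums
  of the last few steps. Bounding it recursively avoids a maximal inequality.
\<close>

primrec lindley :: "(nat \<Rightarrow> real) \<Rightarrow> nat \<Rightarrow> real" where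
  "lindley \<xi> 0 = 0"
| "lindley \<xi> (Suc n) = max 0 (lindley \<xi> n + \<xi> n)"

lemma sum_le_lindley: "k \<le> n \<Longrightarrow> sum \<xi> {k..<n} \<le> lindley \<xi> n"
proof (induction n)
  case (Suc n)
  then show ?case by (cases "k = Suc n") auto
qed simp

lemma lindley_cong: "(\<And>i. i < n \<Longrightarrow> \<xi> i = \<xi>' i) \<Longrightarrow> lindley \<xi> n = lindley \<xi>' n"
  by (induction n) auto

lemma borel_measurable_lindley:
  assumes "\<And>i. i < n \<Longrightarrow> (\<lambda>\<omega>. \<xi> \<omega> i) \<in> borel_measurable M"
  shows "(\<lambda>\<omega>. lindley (\<xi> \<omega>) n) \<in> borel_measurable M"
  using assms by (induction n) auto

text \<open>
  This is \<open>2 * cosh (l * y)\<close>. An even function is needed: the recursion cuts off negative values, which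
  is dominated by reflecting them, and an even function takes the same value at \<open>y\<close> and \<open>\<bar>y\<bar>\<close>.
\<close>

definition sym_exp :: "real \<Rightarrow> real \<Rightarrow> real" where
  "sym_exp l y = exp (l * y) + exp (- l * y)"

lemma sym_exp_max_0: "sym_exp l (max 0 y) \<le> sym_exp l y"
proof -
  have "2 \<le> exp a + exp (- a)" for a :: real
    using exp_ge_add_one_self[of a] exp_ge_add_one_self[of "- a"] by linarith
  then show ?thesis by (auto simp: sym_exp_def max_def)
qed

lemma exp_abs_le_sym_exp:
  assumes "0 \<le> l" "y \<le> P" "- y \<le> N"
  shows "exp (l * \<bar>y\<bar>) \<le> sym_exp l P + sym_exp l N"
proof -
  have "exp (l * \<bar>y\<bar>) \<le> exp (l * P) + exp (l * N)"
  proof (cases "0 \<le> y")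
    case True
    then have "exp (l * \<bar>y\<bar>) \<le> exp (l * P)" using assms by (simp add: mult_left_mono)
    then show ?thesis by (simp add: add_increasing2)
  next
    case False
    then have "l * \<bar>y\<bar> \<le> l * N" using assms by (intro mult_left_mono) auto
    then have "exp (l * \<bar>y\<bar>) \<le> exp (l * N)" by simp
    then show ?thesis by (simp add: add_increasing)
  qed
  moreover have "0 < exp (- l * P)" "0 < exp (- l * N)" by auto
  ultimately show ?thesis unfolding sym_exp_def by linarith
qed

lemma (in prob_space) nn_integral_indep_mult:
  assumes "indep_var borel X borel (Y :: 'a \<Rightarrow> ennreal)"
  shows "(\<integral>\<^sup>+\<omega>. X \<omega> * Y \<omega> \<partial>M) = (\<integral>\<^sup>+\<omega>. X \<omega> \<partial>M) * (\<integral>\<^sup>+\<omega>. Y \<omega> \<partial>M)"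
proof -
  have "case_bool borel (borel :: ennreal measure) = (\<lambda>_. borel)" by (simp add: fun_eq_iff split: bool.split)
  then have "indep_vars (\<lambda>_. borel) (case_bool X Y) UNIV"
    using assms unfolding indep_var_def by simp
  from indep_vars_nn_integral[OF _ this] show ?thesis by (simp add: UNIV_bool mult.commute)
qed

text \<open>
  One step of the recursion replaces \<open>P\<close> by \<open>max 0 (P + \<xi>)\<close>, which does not exceed \<open>P + \<xi>\<close> under
  \<open>sym_exp\<close>; and an independent symmetric step \<open>\<xi>\<close> multiplies the expectation of \<open>sym_exp l P\<close> by
  its own moment generating function. So the maximum of the walk has, up to the factor 2, the same
  exponential moments as its end point, whatever the number of steps.
\<close>

lemma (in prob_space) nn_integral_sym_exp_lindley:
  assumes indep: "indep_vars (\<lambda>_. borel) \<xi> {..<n}"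
    and mgf: "\<And>i l. i < n \<Longrightarrow> (\<integral>\<^sup>+\<omega>. ennreal (exp (l * \<xi> i \<omega>)) \<partial>M) = ennreal (exp (l\<^sup>2 * v / 2))"
  shows "(\<integral>\<^sup>+\<omega>. ennreal (sym_exp l (lindley (\<lambda>i. \<xi> i \<omega>) n)) \<partial>M) \<le> ennreal (2 * exp (l\<^sup>2 * (real n * v) / 2))"
  using assms
proof (induction n)
  case 0
  then show ?case by (simp add: sym_exp_def emeasure_space_1)
next
  case (Suc n)
  define P where "P \<omega> = lindley (\<lambda>i. \<xi> i \<omega>) n" for \<omega>
  have indep_n: "indep_vars (\<lambda>_. borel) \<xi> {..<n}"
    using Suc.prems(1) by (rule indep_vars_subset) auto
  have meas: "random_variable borel (\<xi> i)" if "i < Suc n" for i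
    using Suc.prems(1) that by (auto simp: indep_vars_def)
  have P_meas: "P \<in> borel_measurable M"
    unfolding P_def using meas by (intro borel_measurable_lindley) auto
  have split: "(\<integral>\<^sup>+\<omega>. ennreal (exp (c * (P \<omega> + \<xi> n \<omega>))) \<partial>M)
      = (\<integral>\<^sup>+\<omega>. ennreal (exp (c * P \<omega>)) \<partial>M) * ennreal (exp (c\<^sup>2 * v / 2))" for c
  proof -
    let ?f = "\<lambda>\<zeta>. ennreal (exp (c * lindley \<zeta> n))" and ?g = "\<lambda>\<zeta>. ennreal (exp (c * \<zeta> n))"
    have "indep_var borel (?f \<circ> (\<lambda>\<omega>. \<lambda>i\<in>{..<n}. \<xi> i \<omega>)) borel (?g \<circ> (\<lambda>\<omega>. \<lambda>i\<in>{n}. \<xi> i \<omega>))"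
    proof (rule indep_var_compose[OF indep_var_restrict[OF Suc.prems(1)]])
      have "(\<lambda>\<zeta>. lindley \<zeta> n) \<in> borel_measurable (PiM {..<n} (\<lambda>_. borel))"
        by (intro borel_measurable_lindley) auto
      then show "?f \<in> borel_measurable (PiM {..<n} (\<lambda>_. borel))" by measurable
      show "?g \<in> borel_measurable (PiM {n} (\<lambda>_. borel))" by measurable
    qed auto
    moreover have "lindley (\<lambda>i\<in>{..<n}. \<xi> i \<omega>) n = P \<omega>" for \<omega>
      unfolding P_def by (rule lindley_cong) simp
    ultimately have "indep_var borel (\<lambda>\<omega>. ennreal (exp (c * P \<omega>))) borel (\<lambda>\<omega>. ennreal (exp (c * \<xi> n \<omega>)))"
      by (simp add: comp_def)
    from nn_integral_indep_mult[OF this] show ?thesis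
      using Suc.prems(2)[of n c] by (simp add: ennreal_mult'[symmetric] exp_add[symmetric] distrib_left)
  qed
  have "(\<integral>\<^sup>+\<omega>. ennreal (sym_exp l (lindley (\<lambda>i. \<xi> i \<omega>) (Suc n))) \<partial>M)
      \<le> (\<integral>\<^sup>+\<omega>. ennreal (sym_exp l (P \<omega> + \<xi> n \<omega>)) \<partial>M)"
    by (intro nn_integral_mono ennreal_leI) (simp add: P_def sym_exp_max_0)
  also have "\<dots> = (\<integral>\<^sup>+\<omega>. ennreal (exp (l * (P \<omega> + \<xi> n \<omega>))) \<partial>M) + (\<integral>\<^sup>+\<omega>. ennreal (exp (- l * (P \<omega> + \<xi> n \<omega>))) \<partial>M)"
    unfolding sym_exp_def using P_meas meas[of n]
    by (subst nn_integral_add[symmetric]) (auto simp: ennreal_plus[symmetric] simp del: ennreal_plus)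
  also have "\<dots> = (\<integral>\<^sup>+\<omega>. ennreal (sym_exp l (P \<omega>)) \<partial>M) * ennreal (exp (l\<^sup>2 * v / 2))"
    unfolding split sym_exp_def using P_meas
    by (subst ennreal_plus) (auto simp: nn_integral_add distrib_right)
  also have "\<dots> \<le> ennreal (2 * exp (l\<^sup>2 * (real n * v) / 2)) * ennreal (exp (l\<^sup>2 * v / 2))"
    unfolding P_def using Suc.IH[OF indep_n] Suc.prems(2) by (intro mult_right_mono) auto
  also have "\<dots> = ennreal (2 * exp (l\<^sup>2 * (real (Suc n) * v) / 2))"
    by (simp add: ennreal_mult'[symmetric] exp_add[symmetric] algebra_simps add_divide_distrib)
  finally show ?case .
qed

definition grid_increment :: "real \<Rightarrow> real \<Rightarrow> nat \<Rightarrow> (real \<Rightarrow> real) \<Rightarrow> nat \<Rightarrow> real" where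
  "grid_increment u v n w i =
     w (u + real (Suc i) * ((v - u) / real n)) - w (u + real i * ((v - u) / real n))"

text \<open>
  An upper bound for the exponential of the largest increment of \<open>w\<close> between a time in \<open>[u, v]\<close> and \<open>v\<close>.
  It looks at countably many times only, which makes it measurable; with the lower limit over
  the grids its expectation is controlled by Fatou's lemma. The two terms take care of the two signs of
  the increment. The grids have \<open>n + 1\<close> cells to avoid a division by zero.
\<close>

definition oscillation_weight :: "real \<Rightarrow> real \<Rightarrow> real \<Rightarrow> (real \<Rightarrow> real) \<Rightarrow> ennreal" where
  "oscillation_weight l u v w = liminf (\<lambda>n. ennreal (
     sym_exp l (lindley (grid_increment u v (Suc n) w) (Suc n)) +
     sym_exp l (lindley (\<lambda>i. - grid_increment u v (Suc n) w i) (Suc n))))"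

text \<open>
  The grid points next to \<open>s\<close> on the left converge to \<open>s\<close>, and the increment from such a grid point
  to \<open>v\<close> is a sum of final steps, hence bounded by the Lindley recursion.
\<close>

lemma exp_increment_to_end_le_oscillation_weight:
  assumes l: "0 \<le> l" and uv: "u < v" and cont: "continuous_on {u..v} w" and s: "s \<in> {u..v}"
  shows "ennreal (exp (l * \<bar>w v - w s\<bar>)) \<le> oscillation_weight l u v w"
proof -
  define h where "h n = (v - u) / real (Suc n)" for n
  define k where "k n = nat \<lfloor>(s - u) / h n\<rfloor>" for n
  define \<tau> where "\<tau> n = u + real (k n) * h n" for n
  have h: "0 < h n" "real (Suc n) * h n = v - u" for n using uv by (auto simp: h_def)
  have k: "real (k n) \<le> (s - u) / h n" "(s - u) / h n < real (k n) + 1" for n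
    using s h(1)[of n] unfolding k_def by (auto simp: of_nat_nat)
  have \<tau>: "\<tau> n \<le> s" "s - h n \<le> \<tau> n" "u \<le> \<tau> n" for n
    using k[of n] h(1)[of n] by (auto simp: \<tau>_def field_simps)
  have kn: "k n \<le> Suc n" for n
  proof -
    have "real (k n) * h n \<le> real (Suc n) * h n" using \<tau>(1)[of n] s h(2)[of n] by (simp add: \<tau>_def)
    then show ?thesis using h(1)[of n] by (simp only: mult_le_cancel_right_pos of_nat_le_iff)
  qed
  have h0: "h \<longlonglongrightarrow> 0"
    unfolding h_def using LIMSEQ_Suc[OF lim_const_over_n[of "v - u"]] by simp
  have "\<tau> \<longlonglongrightarrow> s"
  proof (rule tendsto_sandwich[of "\<lambda>n. s - h n" \<tau> _ "\<lambda>_. s"])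
    show "(\<lambda>n. s - h n) \<longlonglongrightarrow> s" using tendsto_diff[OF tendsto_const h0, of s] by simp
  qed (use \<tau> in auto)
  then have "(\<lambda>n. w (\<tau> n)) \<longlonglongrightarrow> w s"
    using s \<tau> by (intro continuous_on_tendsto_compose[OF cont]) (auto intro!: always_eventually intro: order_trans)
  then have lim: "(\<lambda>n. ennreal (exp (l * \<bar>w v - w (\<tau> n)\<bar>))) \<longlonglongrightarrow> ennreal (exp (l * \<bar>w v - w s\<bar>))"
    by (intro tendsto_ennrealI tendsto_intros)
  have sum_inc: "sum (grid_increment u v (Suc n) w) {k n..<Suc n} = w v - w (\<tau> n)" for n
  proof -
    have "sum (grid_increment u v (Suc n) w) {k n..<Suc n} = w (u + real (Suc n) * h n) - w (u + real (k n) * h n)"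
      unfolding grid_increment_def h_def[symmetric] by (rule sum_Suc_diff'[OF kn])
    then show ?thesis using h(2)[of n] by (simp add: \<tau>_def)
  qed
  have "ennreal (exp (l * \<bar>w v - w s\<bar>)) = liminf (\<lambda>n. ennreal (exp (l * \<bar>w v - w (\<tau> n)\<bar>)))"
    using lim_imp_Liminf[OF _ lim] by simp
  also have "\<dots> \<le> oscillation_weight l u v w"
    unfolding oscillation_weight_def
  proof (intro Liminf_mono always_eventually allI ennreal_leI exp_abs_le_sym_exp l)
    fix n
    show "w v - w (\<tau> n) \<le> lindley (grid_increment u v (Suc n) w) (Suc n)"
      using sum_le_lindley[OF kn] sum_inc[of n] by metis
    show "- (w v - w (\<tau> n)) \<le> lindley (\<lambda>i. - grid_increment u v (Suc n) w i) (Suc n)"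
      using sum_le_lindley[OF kn, of "\<lambda>i. - grid_increment u v (Suc n) w i" n] sum_inc[of n]
      by (simp only: sum_negf)
  qed
  finally show ?thesis .
qed

text \<open>
  Passing through the right end point \<open>v\<close> costs a factor 2 in the exponent.
\<close>

lemma exp_increment_le_oscillation_weight:
  assumes l: "0 \<le> l" and uv: "u < v" and cont: "continuous_on {u..v} w"
    and s: "s \<in> {u..v}" "s' \<in> {u..v}"
  shows "ennreal (exp (l * \<bar>w s - w s'\<bar>)) \<le> oscillation_weight (2 * l) u v w"
proof -
  have *: "ennreal (exp (l * \<bar>w s - w s'\<bar>)) \<le> oscillation_weight (2 * l) u v w"
    if "r \<in> {u..v}" "\<bar>w s - w s'\<bar> \<le> \<bar>w v - w r\<bar> + \<bar>w v - w r\<bar>" for r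
  proof -
    have "l * \<bar>w s - w s'\<bar> \<le> (2 * l) * \<bar>w v - w r\<bar>"
      using mult_left_mono[OF that(2) l] by (simp add: distrib_left)
    then have "ennreal (exp (l * \<bar>w s - w s'\<bar>)) \<le> ennreal (exp ((2 * l) * \<bar>w v - w r\<bar>))"
      by (intro ennreal_leI) simp
    also have "\<dots> \<le> oscillation_weight (2 * l) u v w"
      using l by (intro exp_increment_to_end_le_oscillation_weight uv cont that) simp
    finally show ?thesis .
  qed
  have triangle: "\<bar>w s - w s'\<bar> \<le> \<bar>w v - w s\<bar> + \<bar>w v - w s'\<bar>" by linarith
  show ?thesis
  proof (cases "\<bar>w v - w s\<bar> \<le> \<bar>w v - w s'\<bar>")
    case True
    then show ?thesis by (intro *[OF s(2)] order_trans[OF triangle] add_mono) auto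
  next
    case False
    then show ?thesis by (intro *[OF s(1)] order_trans[OF triangle] add_mono) auto
  qed
qed

lemma grid_point_nonneg: "0 \<le> u \<Longrightarrow> u \<le> v \<Longrightarrow> 0 \<le> u + real i * ((v - u) / real n)"
  by simp

lemma oscillation_weight_restrict:
  assumes "0 \<le> u" "u \<le> v"
  shows "oscillation_weight l u v (restrict w {0..}) = oscillation_weight l u v w"
proof -
  have "grid_increment u v n (restrict w {0..}) = grid_increment u v n w" for n
    using grid_point_nonneg[OF assms] by (simp add: grid_increment_def fun_eq_iff del: of_nat_Suc)
  then show ?thesis by (simp add: oscillation_weight_def)
qed

lemma borel_measurable_oscillation_weight:
  assumes "\<And>t. 0 \<le> t \<Longrightarrow> (\<lambda>\<omega>. w \<omega> t) \<in> borel_measurable M" and "0 \<le> u" "u \<le> v"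
  shows "(\<lambda>\<omega>. oscillation_weight l u v (w \<omega>)) \<in> borel_measurable M"
proof -
  have [measurable]: "(\<lambda>\<omega>. grid_increment u v n (w \<omega>) i) \<in> borel_measurable M" for n i
    unfolding grid_increment_def
    by (intro borel_measurable_diff assms grid_point_nonneg)
  have [measurable]: "(\<lambda>\<omega>. lindley (grid_increment u v n (w \<omega>)) k) \<in> borel_measurable M"
    "(\<lambda>\<omega>. lindley (\<lambda>i. - grid_increment u v n (w \<omega>) i) k) \<in> borel_measurable M" for n k
    by (intro borel_measurable_lindley; measurable)+
  show ?thesis unfolding oscillation_weight_def sym_exp_def by measurable
qed

lemma (in prob_space) nn_integral_oscillation_weight:
  assumes W: "standard_brownian_motion M W" and uv: "0 \<le> u" "u < v"
  shows "(\<integral>\<^sup>+\<omega>. oscillation_weight l u v (\<lambda>t. W t \<omega>) \<partial>M) \<le> ennreal (4 * exp (l\<^sup>2 * (v - u) / 2))"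
proof -
  have W_meas: "W t \<in> borel_measurable M" if "0 \<le> t" for t
    using W that by (simp add: standard_brownian_motion_def)
  define f where "f n \<omega> = ennreal (
     sym_exp l (lindley (grid_increment u v (Suc n) (\<lambda>t. W t \<omega>)) (Suc n)) +
     sym_exp l (lindley (\<lambda>i. - grid_increment u v (Suc n) (\<lambda>t. W t \<omega>) i) (Suc n)))" for n \<omega>
  have inc_meas[measurable]: "(\<lambda>\<omega>. grid_increment u v n (\<lambda>t. W t \<omega>) i) \<in> borel_measurable M" for n i
    unfolding grid_increment_def using uv
    by (intro borel_measurable_diff W_meas grid_point_nonneg) auto
  have lin_meas[measurable]: "(\<lambda>\<omega>. lindley (grid_increment u v n (\<lambda>t. W t \<omega>)) k) \<in> borel_measurable M"
    "(\<lambda>\<omega>. lindley (\<lambda>i. - grid_increment u v n (\<lambda>t. W t \<omega>) i) k) \<in> borel_measurable M" for n k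
    by (intro borel_measurable_lindley; measurable)+
  have bound: "(\<integral>\<^sup>+\<omega>. f n \<omega> \<partial>M) \<le> ennreal (4 * exp (l\<^sup>2 * (v - u) / 2))" for n
  proof -
    define h where "h = (v - u) / real (Suc n)"
    define \<tau> where "\<tau> i = u + real i * h" for i
    define \<xi> where "\<xi> i \<omega> = grid_increment u v (Suc n) (\<lambda>t. W t \<omega>) i" for i \<omega>
    have h: "0 < h" using uv by (simp add: h_def)
    have \<tau>: "0 \<le> \<tau> i" "\<tau> i < \<tau> (Suc i)" "\<tau> (Suc i) - \<tau> i = h" for i
      using uv h by (auto simp: \<tau>_def algebra_simps)
    have \<xi>_eq: "\<xi> i = (\<lambda>\<omega>. W (\<tau> (Suc i)) \<omega> - W (\<tau> i) \<omega>)" for i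
      by (simp add: fun_eq_iff \<xi>_def \<tau>_def grid_increment_def h_def del: of_nat_Suc times_divide_eq_right)
    have indep: "indep_vars (\<lambda>_. borel) \<xi> {..<Suc n}"
    proof -
      have "\<forall>(n::nat) \<tau>. 0 \<le> \<tau> 0 \<longrightarrow> (\<forall>i<n. \<tau> i \<le> \<tau> (Suc i)) \<longrightarrow>
          indep_vars (\<lambda>_. borel) (\<lambda>i \<omega>. W (\<tau> (Suc i)) \<omega> - W (\<tau> i) \<omega>) {..<n}"
        using W unfolding standard_brownian_motion_def by (elim conjE)
      from this[rule_format, of \<tau> "Suc n"] show ?thesis
        unfolding \<xi>_eq[abs_def] using \<tau>(1)[of 0] less_imp_le[OF \<tau>(2)] by blast
    qed
    have dist: "distributed M lborel (\<xi> i) (normal_density 0 (sqrt h))" for i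
    proof -
      have "\<forall>s t. 0 \<le> s \<longrightarrow> s < t \<longrightarrow>
          distributed M lborel (\<lambda>\<omega>. W t \<omega> - W s \<omega>) (normal_density 0 (sqrt (t - s)))"
        using W unfolding standard_brownian_motion_def by (elim conjE)
      from this[rule_format, OF \<tau>(1,2), of i] show ?thesis unfolding \<xi>_eq \<tau>(3) .
    qed
    have mgf: "(\<integral>\<^sup>+\<omega>. ennreal (exp (c * \<xi> i \<omega>)) \<partial>M) = ennreal (exp (c\<^sup>2 * h / 2))" for c i
      using nn_integral_exp_normal[OF dist, of c i] h by simp
    have total: "real (Suc n) * h = v - u" by (simp add: h_def)
    have 1: "(\<integral>\<^sup>+\<omega>. ennreal (sym_exp l (lindley (\<lambda>i. \<xi> i \<omega>) (Suc n))) \<partial>M) \<le> ennreal (2 * exp (l\<^sup>2 * (v - u) / 2))"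
      unfolding total[symmetric] by (rule nn_integral_sym_exp_lindley[OF indep mgf])
    have 2: "(\<integral>\<^sup>+\<omega>. ennreal (sym_exp l (lindley (\<lambda>i. - \<xi> i \<omega>) (Suc n))) \<partial>M) \<le> ennreal (2 * exp (l\<^sup>2 * (v - u) / 2))"
      unfolding total[symmetric]
    proof (rule nn_integral_sym_exp_lindley)
      show "indep_vars (\<lambda>_. borel) (\<lambda>i \<omega>. - \<xi> i \<omega>) {..<Suc n}"
        by (rule indep_vars_compose2[OF indep]) simp
      show "(\<integral>\<^sup>+\<omega>. ennreal (exp (c * - \<xi> i \<omega>)) \<partial>M) = ennreal (exp (c\<^sup>2 * h / 2))" for c i
        using mgf[of "- c" i] by simp
    qed
    have "(\<integral>\<^sup>+\<omega>. f n \<omega> \<partial>M) = (\<integral>\<^sup>+\<omega>. ennreal (sym_exp l (lindley (\<lambda>i. \<xi> i \<omega>) (Suc n))) \<partial>M)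
        + (\<integral>\<^sup>+\<omega>. ennreal (sym_exp l (lindley (\<lambda>i. - \<xi> i \<omega>) (Suc n))) \<partial>M)"
      unfolding f_def \<xi>_def
      by (subst nn_integral_add[symmetric]) (auto simp: sym_exp_def[abs_def] simp del: lindley.simps)
    also have "\<dots> \<le> ennreal (2 * exp (l\<^sup>2 * (v - u) / 2)) + ennreal (2 * exp (l\<^sup>2 * (v - u) / 2))"
      by (intro add_mono 1 2)
    also have "\<dots> = ennreal (4 * exp (l\<^sup>2 * (v - u) / 2))"
      by (simp add: ennreal_plus[symmetric] del: ennreal_plus)
    finally show ?thesis .
  qed
  have "(\<integral>\<^sup>+\<omega>. oscillation_weight l u v (\<lambda>t. W t \<omega>) \<partial>M) = (\<integral>\<^sup>+\<omega>. liminf (\<lambda>n. f n \<omega>) \<partial>M)"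
    by (simp add: oscillation_weight_def f_def)
  also have "\<dots> \<le> liminf (\<lambda>n. \<integral>\<^sup>+\<omega>. f n \<omega> \<partial>M)"
    by (rule nn_integral_liminf) (simp add: f_def sym_exp_def del: lindley.simps)
  also have "\<dots> \<le> liminf (\<lambda>n. ennreal (4 * exp (l\<^sup>2 * (v - u) / 2)))"
    by (intro Liminf_mono always_eventually allI bound)
  finally show ?thesis by (simp add: Liminf_const)
qed

text \<open>
  The Borel-Cantelli lemma together with Markov's inequality. The index 0 is left out because the
  particles are numbered from 1.
\<close>

lemma (in prob_space) AE_eventually_less_1:
  fixes f :: "nat \<Rightarrow> 'a \<Rightarrow> ennreal"
  assumes meas: "\<And>n. 1 \<le> n \<Longrightarrow> f n \<in> borel_measurable M"
    and bound: "\<And>n. 1 \<le> n \<Longrightarrow> (\<integral>\<^sup>+\<omega>. f n \<omega> \<partial>M) \<le> ennreal (C * r ^ n)"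
    and r: "0 \<le> C" "0 \<le> r" "r < 1"
  shows "AE \<omega> in M. \<forall>\<^sub>F n in sequentially. f n \<omega> < 1"
proof -
  define A where "A n = {\<omega> \<in> space M. 1 \<le> f (Suc n) \<omega>}" for n
  have [measurable]: "f (Suc n) \<in> borel_measurable M" for n by (rule meas) simp
  have A: "A n \<in> sets M" for n unfolding A_def by measurable
  have "emeasure M (A n) \<le> ennreal (C * r ^ Suc n)" for n
    using nn_integral_Markov_inequality[of "f (Suc n)" "space M" M 1] bound[of "Suc n"]
    by (simp add: A_def cong: nn_integral_cong)
  then have prob_le: "prob (A n) \<le> C * r ^ Suc n" for n
    using r by (simp add: emeasure_eq_measure)
  have "summable (\<lambda>n. C * r ^ Suc n)"
    using r by (intro summable_mult) (simp add: summable_geometric summable_Suc_iff)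
  then have "summable (\<lambda>n. prob (A n))"
    by (rule summable_comparison_test'[of _ 0]) (use prob_le in simp)
  then have "AE \<omega> in M. \<forall>\<^sub>F n in sequentially. \<omega> \<in> space M - A n"
    using A by (intro borel_cantelli_AE1) (auto simp: emeasure_eq_measure)
  then show ?thesis
  proof eventually_elim
    case (elim \<omega>)
    then have "\<forall>\<^sub>F n in sequentially. f (Suc n) \<omega> < 1"
      by eventually_elim (auto simp: A_def not_le)
    then show ?case by (subst (asm) eventually_sequentially_Suc)
  qed
qed

section \<open>Sums of Brownian increments along descending chains of times\<close>

text \<open>
  Descending chains of times are discretised by the numbers of the cells they visit; these are the
  possible sequences of cell numbers when there are \<open>n + 1\<close> times and the largest cell number is \<open>N\<close>.
\<close>

definition cell_chains :: "nat \<Rightarrow> nat \<Rightarrow> (nat \<Rightarrow> nat) set" where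
  "cell_chains n N = {c \<in> {..n} \<rightarrow>\<^sub>E {..N}. antimono_on {..n} c}"

lemma finite_cell_chains: "finite (cell_chains n N)"
  by (rule finite_subset[of _ "{..n} \<rightarrow>\<^sub>E {..N}"]) (auto simp: cell_chains_def intro!: finite_PiE)

text \<open>
  Adding \<open>n - j\<close> to the \<open>j\<close>-th entry makes a chain strictly decreasing, and a strictly decreasing sequence
  is determined by the set of its values: the \<open>j\<close>-th entry is the value with exactly \<open>j\<close> larger ones.
\<close>

lemma card_cell_chains: "card (cell_chains n N) \<le> 2 ^ Suc (n + N)"
proof -
  define s where "s c j = c j + (n - j)" for c :: "nat \<Rightarrow> nat" and j
  have s_strict: "s c j < s c i" if "c \<in> cell_chains n N" "i < j" "j \<le> n" for c i j
    using that monotone_onD[of "{..n}" "(\<le>)" "(\<ge>)" c i j] by (auto simp: cell_chains_def s_def)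
  have rank: "card {y \<in> s c ` {..n}. s c i < y} = i" if c: "c \<in> cell_chains n N" and i: "i \<le> n" for c i
  proof -
    have lt_iff: "s c i < s c j \<longleftrightarrow> j < i" if "j \<le> n" for j
      using s_strict[OF c, of i j] s_strict[OF c, of j i] that i
      by (metis linorder_neqE_nat not_less_iff_gr_or_eq)
    have "{y \<in> s c ` {..n}. s c i < y} = s c ` {..<i}"
      using lt_iff i by force
    moreover have "inj_on (s c) {..<i}"
      using s_strict[OF c] i by (intro linorder_inj_onI') (auto simp: nat_neq_iff)
    ultimately show ?thesis by (simp add: card_image)
  qed
  have "inj_on (\<lambda>c. s c ` {..n}) (cell_chains n N)"
  proof (rule inj_onI)
    fix c c' assume c: "c \<in> cell_chains n N" and c': "c' \<in> cell_chains n N"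
      and eq: "s c ` {..n} = s c' ` {..n}"
    have "c i = c' i" if "i \<le> n" for i
    proof -
      have "s c i \<in> s c' ` {..n}" using eq that by blast
      then obtain j where j: "j \<le> n" "s c i = s c' j" by blast
      have "i = j" using rank[OF c that] rank[OF c' j(1)] eq j(2) by simp
      then show ?thesis using j by (simp add: s_def)
    qed
    then show "c = c'" using c c' by (intro PiE_ext[of _ "{..n}" "\<lambda>_. {..N}"]) (auto simp: cell_chains_def)
  qed
  moreover have "(\<lambda>c. s c ` {..n}) ` cell_chains n N \<subseteq> Pow {..n + N}"
  proof (rule image_subsetI)
    fix c assume c: "c \<in> cell_chains n N"
    have "s c j \<le> n + N" if "j \<le> n" for j
    proof -
      have "c j \<le> N" using c that by (auto simp: cell_chains_def PiE_iff)
      then show ?thesis by (simp add: s_def)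
    qed
    then show "s c ` {..n} \<in> Pow {..n + N}" by auto
  qed
  ultimately have "card (cell_chains n N) \<le> card (Pow {..n + N})"
    by (intro card_inj_on_le) auto
  then show ?thesis by (simp add: card_Pow)
qed

lemma cell_chain_bounds:
  assumes "c \<in> cell_chains n N" "j \<in> {1..n}"
  shows "c j \<le> c (j - 1)"
  using assms monotone_onD[of "{..n}" "(\<le>)" "(\<ge>)" c "j - 1" j] by (auto simp: cell_chains_def)

lemma cell_less:
  fixes a d :: real
  assumes "c \<in> cell_chains n N" "j \<in> {1..n}" "0 < d"
  shows "a + real (c j) * (d / real n) < a + (real (c (j - 1)) + 1) * (d / real n)"
  using cell_chain_bounds[OF assms(1,2)] assms(2,3) by (intro add_strict_left_mono mult_strict_right_mono) auto

lemma less_if_ennreal_exp_less_1: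
  assumes "ennreal (exp (- a)) * ennreal (exp b) < 1"
  shows "b < a"
proof -
  have "ennreal (exp (b - a)) < 1"
    using assms by (simp add: ennreal_mult'[symmetric] exp_diff exp_minus field_simps)
  then show ?thesis by (simp add: ennreal_less_one_iff)
qed

context brownian_setup
begin

lemma AE_continuous_B: "AE \<omega> in M. \<forall>j\<ge>1. continuous_on {0..} (\<lambda>t. B j t \<omega>)"
  using brownian_B by (auto simp: AE_all_countable standard_brownian_motion_def)

lemma borel_measurable_B: "1 \<le> j \<Longrightarrow> 0 \<le> t \<Longrightarrow> B j t \<in> borel_measurable M"
  using brownian_B by (auto simp: standard_brownian_motion_def)

text \<open>
  Different particles are driven by independent Brownian motions, so the expectations multiply and
  only the total length of the time intervals matters.
\<close>

lemma nn_integral_prod_oscillation_weight: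
  assumes J: "finite J" "J \<subseteq> {1..}" and uv: "\<And>j. j \<in> J \<Longrightarrow> 0 \<le> u j \<and> u j < v j"
  shows "(\<integral>\<^sup>+\<omega>. (\<Prod>j\<in>J. oscillation_weight l (u j) (v j) (\<lambda>t. B j t \<omega>)) \<partial>M)
    \<le> ennreal (4 ^ card J * exp (l\<^sup>2 * (\<Sum>j\<in>J. v j - u j) / 2))"
proof -
  have "indep_vars (\<lambda>_. borel)
      (\<lambda>j \<omega>. oscillation_weight l (u j) (v j) (\<lambda>t\<in>{0..}. B j t \<omega>)) J"
  proof (rule indep_vars_compose2[OF indep_vars_subset[OF indep_B J(2)]])
    fix j assume "j \<in> J"
    then show "oscillation_weight l (u j) (v j) \<in> borel_measurable (\<Pi>\<^sub>M t\<in>{0..}. borel)"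
      using uv[of j] by (intro borel_measurable_oscillation_weight) auto
  qed
  then have "(\<integral>\<^sup>+\<omega>. (\<Prod>j\<in>J. oscillation_weight l (u j) (v j) (\<lambda>t\<in>{0..}. B j t \<omega>)) \<partial>M)
      = (\<Prod>j\<in>J. \<integral>\<^sup>+\<omega>. oscillation_weight l (u j) (v j) (\<lambda>t\<in>{0..}. B j t \<omega>) \<partial>M)"
    by (rule indep_vars_nn_integral[OF J(1)]) simp
  then have "(\<integral>\<^sup>+\<omega>. (\<Prod>j\<in>J. oscillation_weight l (u j) (v j) (\<lambda>t. B j t \<omega>)) \<partial>M)
      = (\<Prod>j\<in>J. \<integral>\<^sup>+\<omega>. oscillation_weight l (u j) (v j) (\<lambda>t. B j t \<omega>) \<partial>M)"
    using uv by (simp add: oscillation_weight_restrict less_imp_le)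
  also have "\<dots> \<le> (\<Prod>j\<in>J. ennreal (4 * exp (l\<^sup>2 * (v j - u j) / 2)))"
    using uv J(2) by (intro prod_mono_ennreal nn_integral_oscillation_weight brownian_B) auto
  also have "\<dots> = ennreal (\<Prod>j\<in>J. 4 * exp (l\<^sup>2 * (v j - u j) / 2))"
    by (rule prod_ennreal) simp
  also have "(\<Prod>j\<in>J. 4 * exp (l\<^sup>2 * (v j - u j) / 2)) = 4 ^ card J * exp (l\<^sup>2 * (\<Sum>j\<in>J. v j - u j) / 2)"
    using J(1) by (simp add: prod.distrib exp_sum sum_distrib_left sum_divide_distrib)
  finally show ?thesis .
qed

text \<open>
  The interval \<open>[a, a + d]\<close> is divided into \<open>n\<close> cells, numbered from 0; the number \<open>n\<close> is taken by the
  end point \<open>a + d\<close> alone. The increment of \<open>B j\<close> between \<open>\<sigma> j\<close> and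
  \<open>\<sigma> (j - 1)\<close> lies between the left end of the cell \<open>c j\<close> and the right end of the cell \<open>c (j - 1)\<close>.
  The exponent \<open>sqrt (n / d)\<close> is the one for which a cell of length \<open>d / n\<close> contributes a bounded
  factor, so that the expectation is exponential in \<open>n\<close>, like the number of chains; the 2 in front of it
  comes from \<open>exp_increment_le_oscillation_weight\<close>.
\<close>

definition chain_weight :: "real \<Rightarrow> real \<Rightarrow> nat \<Rightarrow> (nat \<Rightarrow> nat) \<Rightarrow> 'a \<Rightarrow> ennreal" where
  "chain_weight a d n c \<omega> = (\<Prod>j=1..n. oscillation_weight (2 * sqrt (real n / d))
     (a + real (c j) * (d / real n)) (a + (real (c (j - 1)) + 1) * (d / real n)) (\<lambda>t. B j t \<omega>))"

lemma borel_measurable_chain_weight: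
  assumes "0 \<le> a" "0 < d" "c \<in> cell_chains n N"
  shows "chain_weight a d n c \<in> borel_measurable M"
  unfolding chain_weight_def[abs_def]
  using assms cell_less[OF assms(3) _ assms(2), of _ a]
  by (intro borel_measurable_prod_ennreal borel_measurable_oscillation_weight borel_measurable_B)
    (auto intro: less_imp_le)

text \<open>
  The intervals overlap in one cell each, so their lengths add up to at most \<open>2 * d\<close>: once \<open>d\<close> by
  telescoping and once more for the \<open>n\<close> cells that are counted twice.
\<close>

lemma nn_integral_chain_weight:
  assumes a: "0 \<le> a" and d: "0 < d" and n: "1 \<le> n" and c: "c \<in> cell_chains n n"
  shows "(\<integral>\<^sup>+\<omega>. chain_weight a d n c \<omega> \<partial>M) \<le> ennreal ((4 * exp 4) ^ n)"
proof -
  define h where "h = d / real n"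
  define l where "l = sqrt (real n / d)"
  define u where "u j = a + real (c j) * h" for j
  define v where "v j = a + (real (c (j - 1)) + 1) * h" for j
  have h: "0 < h" using d n by (simp add: h_def)
  have lh: "l\<^sup>2 * h = 1" using d n by (simp add: l_def h_def)
  have uv: "0 \<le> u j \<and> u j < v j" if "j \<in> {1..n}" for j
  proof
    show "0 \<le> u j" using a h by (simp add: u_def)
    show "u j < v j" using cell_less[OF c that d, of a] by (simp add: u_def v_def h_def)
  qed
  have "(\<Sum>j=1..n. real (c (j - 1)) - real (c j)) \<le> real n"
  proof -
    have "(\<Sum>j=1..n. real (c (j - 1)) - real (c j)) = real (c 0) - real (c n)"
      using sum_telescope''[of 0 n "\<lambda>j. - real (c j)"] by (simp add: atLeastAtMost_def) 
    also have "c 0 \<le> n" using c by (auto simp: cell_chains_def PiE_iff)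
    then have "real (c 0) - real (c n) \<le> real n" by simp
    finally show ?thesis .
  qed
  then have "(\<Sum>j=1..n. real (c (j - 1)) - real (c j) + 1) * h \<le> (2 * real n) * h"
    using h by (intro mult_right_mono) (auto simp: sum.distrib)
  moreover have "(\<Sum>j=1..n. v j - u j) = (\<Sum>j=1..n. real (c (j - 1)) - real (c j) + 1) * h"
    unfolding sum_distrib_right by (intro sum.cong refl) (simp add: u_def v_def algebra_simps)
  ultimately have "l\<^sup>2 * (\<Sum>j=1..n. v j - u j) \<le> l\<^sup>2 * (2 * real n * h)"
    by (intro mult_left_mono) auto
  also have "\<dots> = 2 * real n" using lh by (simp add: mult.commute mult.left_commute)
  finally have le: "(2 * l)\<^sup>2 * (\<Sum>j=1..n. v j - u j) / 2 \<le> 4 * real n"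
    by (simp add: power_mult_distrib)
  have "(\<integral>\<^sup>+\<omega>. chain_weight a d n c \<omega> \<partial>M) \<le> ennreal (4 ^ card {1..n} * exp ((2 * l)\<^sup>2 * (\<Sum>j=1..n. v j - u j) / 2))"
    unfolding chain_weight_def h_def[symmetric] l_def[symmetric] u_def[symmetric] v_def[symmetric]
    using uv by (intro nn_integral_prod_oscillation_weight) auto
  also have "\<dots> \<le> ennreal (4 ^ n * exp (4 * real n))"
    using le by (intro ennreal_leI mult_mono) auto
  also have "4 ^ n * exp (4 * real n) = (4 * exp 4) ^ n"
    by (simp add: power_mult_distrib exp_of_nat2_mult)
  finally show ?thesis .
qed

lemma increments_along_chain_le_weight:
  assumes a: "0 \<le> a" and d: "0 < d" and n: "1 \<le> n"
    and cont: "\<And>j. 1 \<le> j \<Longrightarrow> continuous_on {0..} (\<lambda>t. B j t \<omega>)"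
    and \<sigma>: "\<And>j. \<sigma> j \<in> {a..a + d}" "antimono \<sigma>"
  shows "ennreal (exp (sqrt (real n / d) * (\<Sum>j=1..n. \<bar>B j (\<sigma> (j - 1)) \<omega> - B j (\<sigma> j) \<omega>\<bar>)))
    \<le> (\<Sum>c\<in>cell_chains n n. chain_weight a d n c \<omega>)"
proof -
  define h where "h = d / real n"
  define l where "l = sqrt (real n / d)"
  define c where "c = (\<lambda>j\<in>{..n}. nat \<lfloor>(\<sigma> j - a) / h\<rfloor>)"
  have h: "0 < h" "real n * h = d" using d n by (auto simp: h_def)
  have c_le: "real (c j) * h \<le> \<sigma> j - a" and c_gt: "\<sigma> j - a < (real (c j) + 1) * h" if "j \<le> n" for j
  proof -
    have "real (c j) = of_int \<lfloor>(\<sigma> j - a) / h\<rfloor>"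
      using \<sigma>(1)[of j] h that by (simp add: c_def)
    then have "real (c j) \<le> (\<sigma> j - a) / h" "(\<sigma> j - a) / h < real (c j) + 1" by linarith+
    then show "real (c j) * h \<le> \<sigma> j - a" "\<sigma> j - a < (real (c j) + 1) * h"
      using h by (auto simp: field_simps)
  qed
  have c_chain: "c \<in> cell_chains n n"
    unfolding cell_chains_def
  proof (intro CollectI conjI)
    have "c j \<le> n" if "j \<le> n" for j
    proof -
      have "real (c j) * h \<le> real n * h" using c_le[OF that] \<sigma>(1)[of j] h(2) by auto
      then show ?thesis using h(1) by simp
    qed
    then show "c \<in> {..n} \<rightarrow>\<^sub>E {..n}" by (auto simp: c_def)
    show "antimono_on {..n} c"
    proof (rule monotone_onI)
      fix i j assume "i \<in> {..n}" "j \<in> {..n}" "i \<le> j"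
      moreover have "(\<sigma> j - a) / h \<le> (\<sigma> i - a) / h"
        using antimonoD[OF \<sigma>(2) \<open>i \<le> j\<close>] h by (simp add: divide_right_mono)
      ultimately show "c j \<le> c i" by (auto simp: c_def intro!: nat_mono floor_mono)
    qed
  qed
  have "ennreal (exp (l * (\<Sum>j=1..n. \<bar>B j (\<sigma> (j - 1)) \<omega> - B j (\<sigma> j) \<omega>\<bar>)))
      = (\<Prod>j=1..n. ennreal (exp (l * \<bar>B j (\<sigma> (j - 1)) \<omega> - B j (\<sigma> j) \<omega>\<bar>)))"
    by (simp add: sum_distrib_left exp_sum prod_ennreal)
  also have "\<dots> \<le> chain_weight a d n c \<omega>"
    unfolding chain_weight_def h_def[symmetric] l_def[symmetric]
  proof (rule prod_mono_ennreal)
    fix j assume j: "j \<in> {1..n}"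
    let ?u = "a + real (c j) * h" and ?v = "a + (real (c (j - 1)) + 1) * h"
    have j1: "j - 1 \<le> n" using j by auto
    have "\<sigma> j \<le> \<sigma> (j - 1)" by (rule antimonoD[OF \<sigma>(2)]) simp
    moreover have "?u \<le> \<sigma> j" "\<sigma> (j - 1) \<le> ?v" using c_le[of j] c_gt[OF j1] j by auto
    moreover have "?u < ?v" using cell_less[OF c_chain j d, of a] by (simp add: h_def)
    moreover have "0 \<le> ?u" using a h by simp
    ultimately show "ennreal (exp (l * \<bar>B j (\<sigma> (j - 1)) \<omega> - B j (\<sigma> j) \<omega>\<bar>))
        \<le> oscillation_weight (2 * l) ?u ?v (\<lambda>t. B j t \<omega>)"
      using j d by (intro exp_increment_le_oscillation_weight continuous_on_subset[OF cont])
        (auto simp: l_def)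
  qed
  also have "\<dots> \<le> (\<Sum>c\<in>cell_chains n n. chain_weight a d n c \<omega>)"
    using c_chain by (intro member_le_sum finite_cell_chains) auto
  finally show ?thesis unfolding l_def .
qed

text \<open>
  A union bound over the chains of cells. Their number is at most \<open>2 * 4 ^ n\<close> and each weight has
  expectation at most \<open>(4 * exp 4) ^ n\<close>, so the constant 9 makes
  \<open>exp (- 9 * n) * 2 * 4 ^ n * (4 * exp 4) ^ n = 2 * (16 * exp (- 5)) ^ n\<close> summable. The bound of order
  \<open>sqrt (d * n)\<close> is what matches initial positions growing like \<open>sqrt n\<close>.
\<close>

lemma AE_increments_along_chains_bounded:
  assumes a: "0 \<le> a" and d: "0 < d"
  shows "AE \<omega> in M. \<forall>\<^sub>F n in sequentially. \<forall>\<sigma>. (\<forall>j. \<sigma> j \<in> {a..a + d}) \<and> antimono \<sigma> \<longrightarrow>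
    (\<Sum>j=1..n. \<bar>B j (\<sigma> (j - 1)) \<omega> - B j (\<sigma> j) \<omega>\<bar>) \<le> 9 * sqrt d * sqrt (real n)"
proof -
  define Z where "Z n \<omega> = (\<Sum>c\<in>cell_chains n n. chain_weight a d n c \<omega>)" for n \<omega>
  have Z_meas: "Z n \<in> borel_measurable M" for n
    unfolding Z_def[abs_def] by (intro borel_measurable_sum borel_measurable_chain_weight[OF a d])
  have "AE \<omega> in M. \<forall>\<^sub>F n in sequentially. ennreal (exp (- 9 * real n)) * Z n \<omega> < 1"
  proof (rule AE_eventually_less_1)
    fix n :: nat assume n: "1 \<le> n"
    show "(\<lambda>\<omega>. ennreal (exp (- 9 * real n)) * Z n \<omega>) \<in> borel_measurable M"
      using Z_meas by measurable
    have "(\<integral>\<^sup>+\<omega>. Z n \<omega> \<partial>M) = (\<Sum>c\<in>cell_chains n n. \<integral>\<^sup>+\<omega>. chain_weight a d n c \<omega> \<partial>M)"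
      unfolding Z_def by (intro nn_integral_sum borel_measurable_chain_weight[OF a d])
    also have "\<dots> \<le> (\<Sum>c\<in>cell_chains n n. ennreal ((4 * exp 4) ^ n))"
      by (intro sum_mono nn_integral_chain_weight a d n)
    also have "\<dots> = ennreal (real (card (cell_chains n n)) * (4 * exp 4) ^ n)"
      by (simp add: ennreal_mult' ennreal_of_nat_eq_real_of_nat)
    also have "\<dots> \<le> ennreal (2 * 4 ^ n * (4 * exp 4) ^ n)"
    proof (intro ennreal_leI mult_right_mono)
      have "real (card (cell_chains n n)) \<le> real (2 ^ Suc (n + n))"
        using card_cell_chains[of n n] by (intro of_nat_mono)
      also have "\<dots> = 2 * 4 ^ n" by (simp add: power_add power_mult_distrib[symmetric])
      finally show "real (card (cell_chains n n)) \<le> 2 * 4 ^ n" .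
    qed simp
    finally have "(\<integral>\<^sup>+\<omega>. Z n \<omega> \<partial>M) \<le> ennreal (2 * 4 ^ n * (4 * exp 4) ^ n)" .
    then have "(\<integral>\<^sup>+\<omega>. ennreal (exp (- 9 * real n)) * Z n \<omega> \<partial>M)
        \<le> ennreal (exp (- 9 * real n)) * ennreal (2 * 4 ^ n * (4 * exp 4) ^ n)"
      by (subst nn_integral_cmult[OF Z_meas]) (rule mult_left_mono, auto)
    also have "\<dots> = ennreal (2 * (16 * exp (- 5)) ^ n)"
    proof -
      have "exp (- 9 * real n) = (exp (- 9)) ^ n" by (simp add: exp_of_nat2_mult[symmetric] mult.commute)
      moreover have "(16 :: real) * exp (- 5) = exp (- 9) * (4 * (4 * exp 4))"
        by (simp add: exp_add[symmetric])
      moreover have "(16 :: real) ^ n = 4 ^ n * 4 ^ n" by (simp add: power_mult_distrib[symmetric])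
      ultimately show ?thesis
        by (simp add: ennreal_mult'[symmetric] power_mult_distrib)
    qed
    finally show "(\<integral>\<^sup>+\<omega>. ennreal (exp (- 9 * real n)) * Z n \<omega> \<partial>M) \<le> ennreal (2 * (16 * exp (- 5)) ^ n)" .
  next
    have "(2::real) ^ 5 \<le> exp 1 ^ 5"
      using exp_ge_add_one_self[of 1] by (intro power_mono) auto
    then have "16 < exp (5::real)" by (simp add: exp_of_nat2_mult[symmetric])
    then show "16 * exp (- 5) < (1::real)" by (simp add: exp_minus field_simps)
  qed auto
  then show ?thesis
    using AE_continuous_B
  proof eventually_elim
    case (elim \<omega>)
    from elim(1) eventually_ge_at_top[of 1] show ?case
    proof eventually_elim
      case (elim n)
      show ?case
      proof (intro allI impI)
        fix \<sigma> :: "nat \<Rightarrow> real" assume \<sigma>: "(\<forall>j. \<sigma> j \<in> {a..a + d}) \<and> antimono \<sigma>"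
        define S where "S = (\<Sum>j=1..n. \<bar>B j (\<sigma> (j - 1)) \<omega> - B j (\<sigma> j) \<omega>\<bar>)"
        define l where "l = sqrt (real n / d)"
        have l: "0 < l" using elim d by (simp add: l_def)
        have "ennreal (exp (l * S)) \<le> Z n \<omega>"
          unfolding Z_def l_def S_def
          using \<sigma> \<open>\<forall>j\<ge>1. continuous_on {0..} (\<lambda>t. B j t \<omega>)\<close> elim
          by (intro increments_along_chain_le_weight a d) auto
        then have "ennreal (exp (- 9 * real n)) * ennreal (exp (l * S)) \<le> ennreal (exp (- 9 * real n)) * Z n \<omega>"
          by (intro mult_left_mono) auto
        also have "\<dots> < 1" by (rule elim(1))
        finally have "l * S \<le> 9 * real n"
          using less_if_ennreal_exp_less_1[of "9 * real n" "l * S"] by simp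
        also have "9 * real n = l * (9 * sqrt d * sqrt (real n))"
          using d by (simp add: l_def real_sqrt_divide)
        finally show "S \<le> 9 * sqrt d * sqrt (real n)" using l by simp
      qed
    qed
  qed
qed

text \<open>
  The exponent \<open>l n\<close> minimises the resulting bound \<open>4 * exp (2 * l\<^sup>2 * T - l * \<epsilon> * sqrt n)\<close>, which then decays
  geometrically in \<open>n\<close>.
\<close>

lemma AE_B_le_sqrt:
  assumes T: "0 < T" and \<epsilon>: "0 < \<epsilon>"
  shows "AE \<omega> in M. \<forall>\<^sub>F n in sequentially. \<forall>s\<in>{0..T}. \<bar>B n s \<omega> - B n 0 \<omega>\<bar> \<le> \<epsilon> * sqrt (real n)"
proof -
  define l where "l n = \<epsilon> * sqrt (real n) / (4 * T)" for n
  define r where "r = exp (- \<epsilon>\<^sup>2 / (8 * T))"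
  define H where "H n \<omega> = oscillation_weight (2 * l n) 0 T (\<lambda>t. B n t \<omega>)" for n \<omega>
  define \<kappa> where "\<kappa> n = exp (- (l n * (\<epsilon> * sqrt (real n))))" for n
  have "AE \<omega> in M. \<forall>\<^sub>F n in sequentially. ennreal (\<kappa> n) * H n \<omega> < 1"
  proof (rule AE_eventually_less_1)
    fix n :: nat assume n: "1 \<le> n"
    have H_meas: "H n \<in> borel_measurable M"
      unfolding H_def[abs_def] using T n
      by (intro borel_measurable_oscillation_weight borel_measurable_B) auto
    then show "(\<lambda>\<omega>. ennreal (\<kappa> n) * H n \<omega>) \<in> borel_measurable M" by measurable
    have "(\<integral>\<^sup>+\<omega>. ennreal (\<kappa> n) * H n \<omega> \<partial>M) = ennreal (\<kappa> n) * (\<integral>\<^sup>+\<omega>. H n \<omega> \<partial>M)"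
      by (rule nn_integral_cmult[OF H_meas])
    also have "\<dots> \<le> ennreal (\<kappa> n) * ennreal (4 * exp ((2 * l n)\<^sup>2 * (T - 0) / 2))"
      unfolding H_def using T n
      by (intro mult_left_mono nn_integral_oscillation_weight brownian_B) auto
    also have "\<dots> = ennreal (4 * exp ((2 * l n)\<^sup>2 * T / 2 - l n * (\<epsilon> * sqrt (real n))))"
      by (simp add: ennreal_mult'[symmetric] \<kappa>_def exp_diff exp_minus field_simps)
    also have "(2 * l n)\<^sup>2 * T / 2 - l n * (\<epsilon> * sqrt (real n)) = real n * (- \<epsilon>\<^sup>2 / (8 * T))"
      using T by (simp add: l_def field_simps power2_eq_square)
    also have "exp (real n * (- \<epsilon>\<^sup>2 / (8 * T))) = r ^ n"
      unfolding r_def by (rule exp_of_nat_mult)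
    finally show "(\<integral>\<^sup>+\<omega>. ennreal (\<kappa> n) * H n \<omega> \<partial>M) \<le> ennreal (4 * r ^ n)" .
  qed (use T \<epsilon> in \<open>auto simp: r_def\<close>)
  then show ?thesis
    using AE_continuous_B
  proof eventually_elim
    case (elim \<omega>)
    from elim(1) eventually_ge_at_top[of 1] show ?case
    proof eventually_elim
      case (elim n)
      have l: "0 < l n" using elim T \<epsilon> by (simp add: l_def)
      show ?case
      proof
        fix s assume s: "s \<in> {0..T}"
        define y where "y = \<bar>B n s \<omega> - B n 0 \<omega>\<bar>"
        have "continuous_on {0..T} (\<lambda>t. B n t \<omega>)"
          using \<open>\<forall>j\<ge>1. continuous_on {0..} (\<lambda>t. B j t \<omega>)\<close> elim by (auto intro: continuous_on_subset)
        then have "ennreal (exp (l n * y)) \<le> H n \<omega>"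
          unfolding H_def y_def using T l s by (intro exp_increment_le_oscillation_weight) auto
        then have "ennreal (\<kappa> n) * ennreal (exp (l n * y)) \<le> ennreal (\<kappa> n) * H n \<omega>"
          by (intro mult_left_mono) auto
        also have "\<dots> < 1" by (rule elim(1))
        finally have "l n * y < l n * (\<epsilon> * sqrt (real n))"
          unfolding \<kappa>_def by (rule less_if_ennreal_exp_less_1)
        then show "y \<le> \<epsilon> * sqrt (real n)" using l by simp
      qed
    qed
  qed
qed

end


section \<open>Growth of the particle positions and agreement of paths\<close>

text \<open>
  For large \<open>n\<close> the net downward push on particle \<open>n\<close> is at most half of \<open>1 + x n\<close>, by the assumption on
  the local times. Of the remaining half, at least \<open>c / 2 * sqrt n\<close>, the Brownian motion takes
  away one eighth of \<open>c * sqrt n\<close> and the drift together with the constants another eighth.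
\<close>

lemma particles_stay_high:
  assumes path: "competing_path p g x b X L" and T: "0 \<le> T" and c: "0 < c"
    and G: "\<And>j. 1 \<le> j \<Longrightarrow> \<bar>g j\<bar> \<le> G"
    and b0: "\<And>j. 1 \<le> j \<Longrightarrow> b j 0 = 0"
    and x: "\<forall>\<^sub>F n in sequentially. c * sqrt (real n) \<le> x n"
    and b: "\<forall>\<^sub>F n in sequentially. \<forall>s\<in>{0..T}. \<bar>b n s - b n 0\<bar> \<le> c / 8 * sqrt (real n)"
    and L: "limsup (\<lambda>n. SUP s\<in>{0..T}.
      ereal (((1 - p) * L n s - p * L (n - 1) s) / max 1 (X n 0))) \<le> 0"
  shows "\<forall>\<^sub>F n in sequentially. \<forall>s\<in>{0..T}. c / 4 * sqrt (real n) \<le> X n s"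
proof -
  have "limsup (\<lambda>n. SUP s\<in>{0..T}.
      ereal (((1 - p) * L n s - p * L (n - 1) s) / max 1 (X n 0))) < ereal (1 / 2)"
    using L by (rule le_less_trans) simp
  then have L_small: "\<forall>\<^sub>F n in sequentially. (SUP s\<in>{0..T}.
      ereal (((1 - p) * L n s - p * L (n - 1) s) / max 1 (X n 0))) < ereal (1 / 2)"
    by (rule Limsup_lessD)
  have "filterlim (\<lambda>n. c / 8 * sqrt (real n)) at_top sequentially"
    using c by (intro filterlim_tendsto_pos_mult_at_top[OF tendsto_const]
        filterlim_compose[OF sqrt_at_top filterlim_real_sequentially]) auto
  then have "\<forall>\<^sub>F n in sequentially. G * T + 1 / 2 \<le> c / 8 * sqrt (real n)"
    unfolding filterlim_at_top by blast
  with L_small x b eventually_ge_at_top[of 1] show ?thesis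
  proof eventually_elim
    case (elim n)
    have X0: "X n 0 = x n"
      using competing_path_eq[OF path, of n 0] local_time_start[OF path] b0 elim by simp
    have "0 \<le> c * sqrt (real n)" using c by simp
    then have x_nonneg: "0 \<le> x n" using elim(2) by linarith
    show ?case
    proof
      fix s assume s: "s \<in> {0..T}"
      define \<Lambda> where "\<Lambda> = (1 - p) * L n s - p * L (n - 1) s"
      have "ereal (\<Lambda> / max 1 (X n 0)) \<le> (SUP s\<in>{0..T}.
          ereal (((1 - p) * L n s - p * L (n - 1) s) / max 1 (X n 0)))"
        unfolding \<Lambda>_def by (rule SUP_upper[OF s])
      from le_less_trans[OF this elim(1)] have "\<Lambda> / max 1 (X n 0) < 1 / 2" by simp
      then have "\<Lambda> < max 1 (x n) / 2" by (simp add: X0 field_simps)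
      also have "\<dots> \<le> (1 + x n) / 2" using x_nonneg by simp
      finally have \<Lambda>: "\<Lambda> < (1 + x n) / 2" .
      define e where "e = c / 8 * sqrt (real n)"
      have "\<bar>g n * s\<bar> \<le> G * T"
        using G[of n] elim s by (auto simp: abs_mult intro!: mult_mono)
      then have "- (G * T) \<le> g n * s" by linarith
      moreover have "\<bar>b n s\<bar> \<le> e" using elim s b0 by (auto simp: e_def)
      then have "- e \<le> b n s" by linarith
      moreover have "G * T + 1 / 2 \<le> e" using elim(5) by (simp add: e_def)
      moreover have "8 * e \<le> x n" using elim(2) by (simp add: e_def)
      moreover have "X n s = x n + g n * s + b n s - \<Lambda>"
        using competing_path_eq[OF path, of n s] elim s by (simp add: \<Lambda>_def)
      ultimately have "2 * e \<le> X n s" using \<Lambda> by (simp add: field_simps)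
      then show "c / 4 * sqrt (real n) \<le> X n s" by (simp add: e_def)
    qed
  qed
qed

text \<open>
  The constant \<open>c\<close> depends on the path and on the time horizon \<open>N\<close>. It determines the length
  \<open>d = 1 / (m + 1)\<close> of the intervals, and agreement is then extended from \<open>[0, k * d]\<close> to \<open>[0, (k + 1) * d]\<close>.
  Lengths of this form suffice, so that countably many almost sure statements about chains
  are enough.
\<close>

lemma paths_agree:
  assumes path: "competing_path p g x b X L" and path': "competing_path p g x' b X' L'"
    and p: "0 < p" "p < 1" and G: "\<And>j. 1 \<le> j \<Longrightarrow> \<bar>g j\<bar> \<le> G"
    and start: "\<And>j. 1 \<le> j \<Longrightarrow> X j 0 = X' j 0"
    and chains: "\<And>m k. \<forall>\<^sub>F n in sequentially. \<forall>\<sigma>.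
      (\<forall>j. \<sigma> j \<in> {real k / real (Suc m)..real k / real (Suc m) + 1 / real (Suc m)}) \<and> antimono \<sigma> \<longrightarrow>
      (\<Sum>j=1..n. \<bar>b j (\<sigma> (j - 1)) - b j (\<sigma> j)\<bar>) \<le> 9 * sqrt (1 / real (Suc m)) * sqrt (real n)"
    and growth: "\<And>N. \<exists>c>0. \<forall>\<^sub>F n in sequentially. \<forall>s\<in>{0..real N}. c * sqrt (real n) \<le> X n s"
    and growth': "\<And>N. \<exists>c>0. \<forall>\<^sub>F n in sequentially. \<forall>s\<in>{0..real N}. c * sqrt (real n) \<le> X' n s"
    and j: "1 \<le> j" and t: "0 \<le> t"
  shows "X j t = X' j t"
proof -
  obtain N where N: "t + 1 \<le> real N" using real_arch_simple by blast
  obtain c c' where c: "0 < c" "0 < c'"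
    and X_high: "\<forall>\<^sub>F n in sequentially. \<forall>s\<in>{0..real N}. c * sqrt (real n) \<le> X n s"
    and X'_high: "\<forall>\<^sub>F n in sequentially. \<forall>s\<in>{0..real N}. c' * sqrt (real n) \<le> X' n s"
    using growth[of N] growth'[of N] by blast
  define \<epsilon> where "\<epsilon> = min c c' / 9"
  have "0 < \<epsilon>" using c by (simp add: \<epsilon>_def)
  then obtain m where "inverse (real (Suc m)) < \<epsilon>\<^sup>2"
    using reals_Archimedean[of "\<epsilon>\<^sup>2"] by auto
  then have m: "1 / real (Suc m) < \<epsilon>\<^sup>2" by (simp add: inverse_eq_divide)
  define d where "d = 1 / real (Suc m)"
  have d: "0 < d" "d \<le> 1" by (auto simp: d_def)
  have "sqrt d < \<epsilon>" using m \<open>0 < \<epsilon>\<close> unfolding d_def by (intro real_less_lsqrt) auto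
  then have dc: "9 * sqrt d < c" "9 * sqrt d < c'" by (auto simp: \<epsilon>_def)
  have agree: "real k * d \<le> real N \<Longrightarrow> 1 \<le> i \<Longrightarrow> r \<in> {0..real k * d} \<Longrightarrow> X i r = X' i r" for k i r
  proof (induction k arbitrary: i r)
    case 0
    then show ?case using start by simp
  next
    case (Suc k)
    define a where "a = real k * d"
    have a: "0 \<le> a" "a + d \<le> real N" "real (Suc k) * d = a + d"
      using d Suc.prems(1) by (auto simp: a_def algebra_simps)
    have IH: "X i r = X' i r" if "1 \<le> i" "r \<in> {0..a}" for i r
      using Suc.IH[of i r] that a d unfolding a_def by simp
    show ?case
    proof (cases "r \<le> a")
      case True
      then show ?thesis using IH Suc.prems by simp
    next
      case False
      then have r: "a \<le> r" "r \<le> a + d" using Suc.prems(3) a(3) by auto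
      have eq: "X' i a = X i a" if "1 \<le> i" for i using IH[OF that, of a] a by simp
      have high: "\<forall>\<^sub>F n in sequentially. \<forall>s\<in>{a..a + d}. c * sqrt (real n) \<le> X n s"
        using X_high by eventually_elim (use a in auto)
      have high': "\<forall>\<^sub>F n in sequentially. \<forall>s\<in>{a..a + d}. c' * sqrt (real n) \<le> X' n s"
        using X'_high by eventually_elim (use a in auto)
      have chain: "\<forall>\<^sub>F n in sequentially. \<forall>\<sigma>. (\<forall>j. \<sigma> j \<in> {a..a + d}) \<and> antimono \<sigma> \<longrightarrow>
          (\<Sum>j=1..n. \<bar>b j (\<sigma> (j - 1)) - b j (\<sigma> j)\<bar>) \<le> 9 * sqrt d * sqrt (real n)"
        using chains[where k = k and m = m] by (simp add: a_def d_def del: of_nat_Suc)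
      have "X' i r \<le> X i r"
        by (rule comparison_if_chains_are_short[OF path path' p a(1) _ chain high dc(1) _ Suc.prems(2) r])
          (use G eq in auto)
      moreover have "X i r \<le> X' i r"
        by (rule comparison_if_chains_are_short[OF path' path p a(1) _ chain high' dc(2) _ Suc.prems(2) r])
          (use G eq in auto)
      ultimately show ?thesis by simp
    qed
  qed
  define k where "k = nat \<lceil>t / d\<rceil>"
  have "t / d \<le> real k" "real k \<le> t / d + 1"
    using t d by (auto simp: k_def of_nat_nat)
  then have "t \<le> real k * d" "real k * d \<le> t + d"
    using d by (auto simp: field_simps)
  then show ?thesis using agree[of k j t] t N d j by simp
qed

lemma (in brownian_setup) AE_initial_growth:
  assumes X: "competing_brownian_solution M F B p g x X L" "has_initial_distribution M x \<gamma>"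
    and \<gamma>_growth: "AE y in \<gamma>. liminf (\<lambda>n. ereal (y n / sqrt (real n))) > 0"
  shows "AE \<omega> in M. \<exists>c>0. \<forall>\<^sub>F n in sequentially. c * sqrt (real n) \<le> x n \<omega>"
proof -
  have "x j \<in> borel_measurable M" if "1 \<le> j" for j
    using X(1) that measurable_from_subalg[OF subalgebra_F[of 0]]
    by (auto simp: competing_brownian_solution_def)
  then have x_meas: "(\<lambda>\<omega>. \<lambda>j\<in>{1..}. x j \<omega>) \<in> measurable M real_sequences"
    by (intro measurable_restrict) auto
  have "AE y in distr M real_sequences (\<lambda>\<omega>. \<lambda>j\<in>{1..}. x j \<omega>). liminf (\<lambda>n. ereal (y n / sqrt (real n))) > 0"
    using \<gamma>_growth X(2) unfolding has_initial_distribution_def by (simp only:)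
  from AE_distrD[OF x_meas this] show ?thesis
  proof eventually_elim
    case (elim \<omega>)
    then obtain c where c: "0 < ereal c"
        "ereal c < liminf (\<lambda>n. ereal ((\<lambda>j\<in>{1..}. x j \<omega>) n / sqrt (real n)))"
      using ereal_dense2 by blast
    from less_LiminfD[OF c(2)] eventually_ge_at_top[of 1]
    have "\<forall>\<^sub>F n in sequentially. c * sqrt (real n) \<le> x n \<omega>"
      by eventually_elim (auto simp: field_simps)
    with c(1) show ?case by auto
  qed
qed

lemma (in brownian_setup) AE_particles_stay_high:
  assumes X: "competing_brownian_solution M F B p g x X L" "has_initial_distribution M x \<gamma>"
    and \<gamma>_growth: "AE y in \<gamma>. liminf (\<lambda>n. ereal (y n / sqrt (real n))) > 0"
    and L: "local_time_growth M p X L"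
    and G: "\<And>j. 1 \<le> j \<Longrightarrow> \<bar>g j\<bar> \<le> G"
  shows "AE \<omega> in M. \<forall>N. \<exists>c>0. \<forall>\<^sub>F n in sequentially. \<forall>s\<in>{0..real N}. c * sqrt (real n) \<le> X n s \<omega>"
proof -
  have path: "AE \<omega> in M. competing_path p g (\<lambda>j. x j \<omega>)
      (\<lambda>j t. B j t \<omega>) (\<lambda>j t. X j t \<omega>) (\<lambda>j t. L j t \<omega>)"
    using X(1) by (simp add: competing_brownian_solution_def)
  have B0: "AE \<omega> in M. \<forall>j\<ge>1. B j 0 \<omega> = 0"
    using brownian_B by (auto simp: AE_all_countable standard_brownian_motion_def)
  have B_small: "AE \<omega> in M. \<forall>N m. \<forall>\<^sub>F n in sequentially. \<forall>s\<in>{0..real (Suc N)}.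
      \<bar>B n s \<omega> - B n 0 \<omega>\<bar> \<le> 1 / real (Suc m) * sqrt (real n)"
    unfolding AE_all_countable by (intro allI AE_B_le_sqrt) auto
  have L_small: "AE \<omega> in M. \<forall>N. limsup (\<lambda>n. SUP s\<in>{0..real (Suc N)}.
      ereal (((1 - p) * L n s \<omega> - p * L (n - 1) s \<omega>) / max 1 (X n 0 \<omega>))) \<le> 0"
    unfolding AE_all_countable using L by (auto simp: local_time_growth_def)
  from path B0 B_small L_small AE_initial_growth[OF X \<gamma>_growth] show ?thesis
  proof eventually_elim
    case (elim \<omega>)
    from elim(5) obtain c where c: "0 < c" "\<forall>\<^sub>F n in sequentially. c * sqrt (real n) \<le> x n \<omega>"
      by blast
    obtain m where m: "inverse (real (Suc m)) < c / 8"
      using reals_Archimedean[of "c / 8"] c by auto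
    show ?case
    proof
      fix N
      have small: "\<forall>\<^sub>F n in sequentially. \<forall>s\<in>{0..real (Suc N)}. \<bar>B n s \<omega> - B n 0 \<omega>\<bar> \<le> c / 8 * sqrt (real n)"
        using elim(3)[THEN spec, of N, THEN spec, of m]
      proof eventually_elim
        case (elim n)
        have "1 / real (Suc m) * sqrt (real n) \<le> c / 8 * sqrt (real n)"
          using m by (intro mult_right_mono) (auto simp: inverse_eq_divide)
        with elim show ?case by (meson order_trans)
      qed
      have "\<forall>\<^sub>F n in sequentially. \<forall>s\<in>{0..real (Suc N)}. c / 4 * sqrt (real n) \<le> X n s \<omega>"
        by (rule particles_stay_high[OF elim(1) _ c(1) _ _ c(2) small elim(4)[THEN spec, of N]])
          (use elim(2) G in auto)
      then have "\<forall>\<^sub>F n in sequentially. \<forall>s\<in>{0..real N}. c / 4 * sqrt (real n) \<le> X n s \<omega>"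
        by eventually_elim auto
      then show "\<exists>c>0. \<forall>\<^sub>F n in sequentially. \<forall>s\<in>{0..real N}. c * sqrt (real n) \<le> X n s \<omega>"
        using c(1) by (intro exI[of _ "c / 4"]) auto
    qed
  qed
qed

section \<open>Pathwise uniqueness\<close>

theorem theorem2p6:
  fixes M :: "'a measure" and F :: "real \<Rightarrow> 'a measure" and B :: "nat \<Rightarrow> real \<Rightarrow> 'a \<Rightarrow> real"
    and p :: real and g :: "nat \<Rightarrow> real" and \<gamma> :: "(nat \<Rightarrow> real) measure"
    and x x' :: "nat \<Rightarrow> 'a \<Rightarrow> real"
    and X X' L L' :: "nat \<Rightarrow> real \<Rightarrow> 'a \<Rightarrow> real"
  assumes p: "1 / 2 \<le> p" "p < 1"
    and g: "bdd_above ((\<lambda>j. \<bar>g j\<bar>) ` {1..})"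
    and \<gamma>: "prob_space \<gamma>" "sets \<gamma> = sets real_sequences"
    and \<gamma>_mono: "AE y in \<gamma>. mono_on {1..} y"
    and \<gamma>_growth: "AE y in \<gamma>. liminf (\<lambda>n. ereal (y n / sqrt (real n))) > 0"
    and basis: "brownian_setup M F B"
    and X: "competing_brownian_solution M F B p g x X L" "has_initial_distribution M x \<gamma>"
    and X': "competing_brownian_solution M F B p g x' X' L'" "has_initial_distribution M x' \<gamma>"
    and same_start: "AE \<omega> in M. \<forall>j\<ge>1. X j 0 \<omega> = X' j 0 \<omega>"
    and L: "local_time_growth M p X L"
    and L': "local_time_growth M p X' L'"
  shows "AE \<omega> in M. \<forall>j\<ge>1. \<forall>t\<ge>0. X j t \<omega> = X' j t \<omega>"
proof -
  interpret brownian_setup M F B by (rule basis)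
  obtain G where G: "\<And>j. 1 \<le> j \<Longrightarrow> \<bar>g j\<bar> \<le> G"
    using g unfolding bdd_above_def by auto
  have path: "AE \<omega> in M. competing_path p g (\<lambda>j. x j \<omega>)
      (\<lambda>j t. B j t \<omega>) (\<lambda>j t. X j t \<omega>) (\<lambda>j t. L j t \<omega>)"
    and path': "AE \<omega> in M. competing_path p g (\<lambda>j. x' j \<omega>)
      (\<lambda>j t. B j t \<omega>) (\<lambda>j t. X' j t \<omega>) (\<lambda>j t. L' j t \<omega>)"
    using X(1) X'(1) by (auto simp: competing_brownian_solution_def)
  have chains: "AE \<omega> in M. \<forall>m k. \<forall>\<^sub>F n in sequentially. \<forall>\<sigma>.
      (\<forall>j. \<sigma> j \<in> {real k / real (Suc m)..real k / real (Suc m) + 1 / real (Suc m)}) \<and> antimono \<sigma> \<longrightarrow>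
      (\<Sum>j=1..n. \<bar>B j (\<sigma> (j - 1)) \<omega> - B j (\<sigma> j) \<omega>\<bar>) \<le> 9 * sqrt (1 / real (Suc m)) * sqrt (real n)"
    unfolding AE_all_countable by (intro allI AE_increments_along_chains_bounded) auto
  have growth: "AE \<omega> in M. \<forall>N. \<exists>c>0. \<forall>\<^sub>F n in sequentially. \<forall>s\<in>{0..real N}. c * sqrt (real n) \<le> X n s \<omega>"
    using G by (rule AE_particles_stay_high[OF X \<gamma>_growth L])
  have growth': "AE \<omega> in M. \<forall>N. \<exists>c>0. \<forall>\<^sub>F n in sequentially. \<forall>s\<in>{0..real N}. c * sqrt (real n) \<le> X' n s \<omega>"
    using G by (rule AE_particles_stay_high[OF X' \<gamma>_growth L'])
  from path path' same_start chains growth growth'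
  show ?thesis
  proof eventually_elim
    case (elim \<omega>)
    show ?case
    proof (intro allI impI)
      fix j :: nat and t :: real
      assume j: "1 \<le> j" and t: "0 \<le> t"
      show "X j t \<omega> = X' j t \<omega>"
        using elim p by (intro paths_agree[OF elim(1,2) _ p(2) G _ _ _ _ j t]) auto
    qed
  qed
qed

end
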